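(* Let $G$ be a finite simple graph with no isolated vertices such that its matching complex $M(G)$ is a 2-dimensional homology sphere. Then (up to isomorphism) $G\in\{3P_3,\ P_3\sqcup C_5,\ P_3\sqcup K_{3,2}\}$, and $M(G)$ is the boundary of the bipyramid over $C_n$ for some $n\in\{4,5,6\}$. In particular, if the matching complex of a finite simple graph $G$ with no isolated vertices is a 2-sphere, then $G$ is not connected.
   Context: A matching of a graph $G$ is a set of edges of $G$ no two of which share a vertex. The matching complex $M(G)$ is the simplicial complex whose vertices are the edges of $G$ and whose faces are the matchings of $G$ (including the empty matching). $P_n$ is the path with $n$ vertices, $C_n$ the cycle with $n$ vertices, $K_{m,n}$ the complete bipartite graph; $\sqcup$ is disjoint union and $nH$ denotes $n$ disjoint copies of $H$. The boundary of the bipyramid over $C_n$ is the join of $C_n$ (as a 1-dimensional simplicial complex) with the complex consisting of two isolated points. Fix a field $\Bbbk$; homology is over $\Bbbk$. A homology sphere is a finite $d$-dimensional simplicial complex $\Delta$ such that $\mathrm{link}_\Delta\sigma=\{\tau\in\Delta:\tau\cup\sigma\in\Delta,\tau\cap\sigma=\varnothing\}$ has the homology of a $(d-|\sigma|)$-sphere for all faces $\sigma\in\Delta$, including $\sigma=\varnothing$ (the $(-1)$-sphere is $\{\varnothing\}$); "2-sphere" means 2-dimensional homology sphere. *)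

theory Defs
  imports Complex_Main "HOL-Library.Disjoint_Sets" "HOL-Library.Function_Algebras"
begin

section \<open>Graphs\<close>

record 'a graph =
  verts :: "'a set"
  edges :: "'a set set"

definition finite_simple_graph :: "'a graph \<Rightarrow> bool" where
  "finite_simple_graph G \<longleftrightarrow>
     finite (verts G) \<and> (\<forall>e \<in> edges G. e \<subseteq> verts G \<and> card e = 2)"

definition no_isolated_vertices :: "'a graph \<Rightarrow> bool" where
  "no_isolated_vertices G \<longleftrightarrow> (\<forall>v \<in> verts G. \<exists>e \<in> edges G. v \<in> e)"

definition connected_graph :: "'a graph \<Rightarrow> bool" where
  "connected_graph G \<longleftrightarrow> verts G \<noteq> {} \<and>
     (\<forall>u \<in> verts G. \<forall>v \<in> verts G. (u, v) \<in> {(x, y). {x, y} \<in> edges G}\<^sup>*)"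

definition graph_iso :: "'a graph \<Rightarrow> 'b graph \<Rightarrow> bool" where
  "graph_iso G H \<longleftrightarrow>
     (\<exists>f. bij_betw f (verts G) (verts H) \<and> edges H = (\<lambda>e. f ` e) ` edges G)"

definition path_graph :: "nat \<Rightarrow> nat graph" where
  "path_graph n = \<lparr>verts = {..<n}, edges = {{i, i + 1} | i. i + 1 < n}\<rparr>"

text \<open>Only meaningful for \<open>n \<ge> 3\<close>.\<close>

definition cycle_graph :: "nat \<Rightarrow> nat graph" where
  "cycle_graph n = \<lparr>verts = {..<n}, edges = {{i, (i + 1) mod n} | i. i < n}\<rparr>"

definition complete_bipartite_graph :: "nat \<Rightarrow> nat \<Rightarrow> (nat + nat) graph" where
  "complete_bipartite_graph m n =
     \<lparr>verts = {..<m} <+> {..<n}, edges = {{Inl i, Inr j} | i j. i < m \<and> j < n}\<rparr>"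

definition disjoint_union_graph :: "'a graph \<Rightarrow> 'b graph \<Rightarrow> ('a + 'b) graph" where
  "disjoint_union_graph G H =
     \<lparr>verts = verts G <+> verts H,
      edges = (\<lambda>e. Inl ` e) ` edges G \<union> (\<lambda>e. Inr ` e) ` edges H\<rparr>"

definition copies_graph :: "nat \<Rightarrow> 'a graph \<Rightarrow> (nat \<times> 'a) graph" where
  "copies_graph n G =
     \<lparr>verts = {..<n} \<times> verts G, edges = {Pair i ` e | i e. i < n \<and> e \<in> edges G}\<rparr>"


section \<open>Simplicial complexes\<close>

text \<open>
  A complex is given by its set of faces, including the empty face; its vertex set is
  \<open>\<Union>K\<close>. Finiteness of \<open>K\<close> and closure under subsets force every face to be finite.
\<close>

definition finite_simplicial_complex :: "'v set set \<Rightarrow> bool" where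
  "finite_simplicial_complex K \<longleftrightarrow>
     finite K \<and> {} \<in> K \<and> (\<forall>\<sigma> \<in> K. \<forall>\<tau>. \<tau> \<subseteq> \<sigma> \<longrightarrow> \<tau> \<in> K)"

definition complex_dim :: "'v set set \<Rightarrow> int" where
  "complex_dim K = Max ((\<lambda>\<sigma>. int (card \<sigma>) - 1) ` K)"

definition link :: "'v set set \<Rightarrow> 'v set \<Rightarrow> 'v set set" where
  "link K \<sigma> = {\<tau> \<in> K. \<tau> \<union> \<sigma> \<in> K \<and> \<tau> \<inter> \<sigma> = {}}"

definition complex_iso :: "'v set set \<Rightarrow> 'w set set \<Rightarrow> bool" where
  "complex_iso K L \<longleftrightarrow>
     (\<exists>f. bij_betw f (\<Union>K) (\<Union>L) \<and> L = (\<lambda>\<sigma>. f ` \<sigma>) ` K)"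

definition join :: "'v set set \<Rightarrow> 'w set set \<Rightarrow> ('v + 'w) set set" where
  "join K L = {\<sigma> <+> \<tau> | \<sigma> \<tau>. \<sigma> \<in> K \<and> \<tau> \<in> L}"

definition graph_complex :: "'a graph \<Rightarrow> 'a set set" where
  "graph_complex G = {{}} \<union> {{v} | v. v \<in> verts G} \<union> edges G"

definition two_points :: "bool set set" where
  "two_points = {{}, {False}, {True}}"

definition bipyramid_boundary :: "nat \<Rightarrow> (nat + bool) set set" where
  "bipyramid_boundary n = join (graph_complex (cycle_graph n)) two_points"

definition matching_complex :: "'a graph \<Rightarrow> 'a set set set" where
  "matching_complex G = {F. F \<subseteq> edges G \<and> disjoint F}"


section \<open>Reduced simplicial homology over a field\<close>

text \<open>
  Oriented \<open>i\<close>-chains, without choosing orientations: the list \<open>[v\<^sub>0, \<dots>, v\<^sub>i]\<close> of distinct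
  vertices of an \<open>i\<close>-face stands for that face oriented by \<open>(v\<^sub>0, \<dots>, v\<^sub>i)\<close>, and a chain is its
  coefficient function, which must change sign when the orientation is reversed. Since adjacent
  transpositions generate the symmetric group, it suffices to require this for these.
  The empty list accounts for the empty face in dimension \<open>-1\<close>, so the homology is reduced.
\<close>

definition simplicial_chains :: "'v set set \<Rightarrow> int \<Rightarrow> ('v list \<Rightarrow> 'k::field) set" where
  "simplicial_chains K i = {c.
     (\<forall>xs. c xs \<noteq> 0 \<longrightarrow> distinct xs \<and> set xs \<in> K \<and> int (length xs) = i + 1) \<and>
     (\<forall>us x y vs. c (us @ x # y # vs) = - c (us @ y # x # vs))}"

text \<open>
  The usual \<open>\<partial>[v\<^sub>0, \<dots>, v\<^sub>i] = (\<Sum>j\<le>i. (-1)\<^sup>j [v\<^sub>0, \<dots>, v\<^sub>j\<^sub>-\<^sub>1, v\<^sub>j\<^sub>+\<^sub>1, \<dots>, v\<^sub>i])\<close> on coefficient functions: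
  moving \<open>v\<^sub>j\<close> to the front has sign \<open>(-1)\<^sup>j\<close>, so the coefficient of the oriented face \<open>xs\<close>
  collects the coefficients of all \<open>v # xs\<close>.
\<close>

definition boundary :: "'v set set \<Rightarrow> ('v list \<Rightarrow> 'k::field) \<Rightarrow> 'v list \<Rightarrow> 'k" where
  "boundary K c = (\<lambda>xs. \<Sum>v \<in> \<Union>K. c (v # xs))"

definition simplicial_cycles :: "'v set set \<Rightarrow> int \<Rightarrow> ('v list \<Rightarrow> 'k::field) set" where
  "simplicial_cycles K i = {c \<in> simplicial_chains K i. boundary K c = 0}"

definition boundaries :: "'v set set \<Rightarrow> int \<Rightarrow> ('v list \<Rightarrow> 'k::field) set" where
  "boundaries K i = boundary K ` simplicial_chains K (i + 1)"

definition homology_class ::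
    "'v set set \<Rightarrow> int \<Rightarrow> ('v list \<Rightarrow> 'k::field) \<Rightarrow> ('v list \<Rightarrow> 'k) set" where
  "homology_class K i z = {z + b | b. b \<in> boundaries K i}"

definition reduced_homology :: "'v set set \<Rightarrow> int \<Rightarrow> ('v list \<Rightarrow> 'k::field) set set" where
  "reduced_homology K i = homology_class K i ` simplicial_cycles K i"

definition homology_trivial :: "'k::field itself \<Rightarrow> 'v set set \<Rightarrow> int \<Rightarrow> bool" where
  "homology_trivial _ K i \<longleftrightarrow>
     reduced_homology K i = {homology_class K i (0 :: 'v list \<Rightarrow> 'k)}"

text \<open>
  The reduced homology is isomorphic to \<open>'k\<close> as a vector space over \<open>'k\<close>; sums and
  multiples of classes are those of their representatives.
\<close>

definition homology_one_dimensional :: "'k::field itself \<Rightarrow> 'v set set \<Rightarrow> int \<Rightarrow> bool" where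
  "homology_one_dimensional _ K i \<longleftrightarrow>
     (\<exists>\<phi> :: ('v list \<Rightarrow> 'k) set \<Rightarrow> 'k.
        bij_betw \<phi> (reduced_homology K i) UNIV \<and>
        (\<forall>z \<in> simplicial_cycles K i. \<forall>w \<in> simplicial_cycles K i.
           \<phi> (homology_class K i (z + w)) =
           \<phi> (homology_class K i z) + \<phi> (homology_class K i w)) \<and>
        (\<forall>a. \<forall>z \<in> simplicial_cycles K i.
           \<phi> (homology_class K i (\<lambda>xs. a * z xs)) = a * \<phi> (homology_class K i z)))"

definition has_homology_of_sphere :: "'k::field itself \<Rightarrow> 'v set set \<Rightarrow> int \<Rightarrow> bool" where
  "has_homology_of_sphere k K d \<longleftrightarrow>
     homology_one_dimensional k K d \<and> (\<forall>i. i \<noteq> d \<longrightarrow> homology_trivial k K i)"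

definition homology_sphere :: "'k::field itself \<Rightarrow> int \<Rightarrow> 'v set set \<Rightarrow> bool" where
  "homology_sphere k d K \<longleftrightarrow>
     finite_simplicial_complex K \<and> complex_dim K = d \<and>
     (\<forall>\<sigma> \<in> K. has_homology_of_sphere k (link K \<sigma>) (d - int (card \<sigma>)))"

end

theory Submission imports Defs begin

text \<open>
  Write \<open>M\<close> for the matching complex of the graph. The link of a face
  of \<open>M\<close> is the matching complex of the graph that remains when the end vertices of the edges
  in that face are deleted, so the hypothesis speaks about such remainders.

  \<^emph>\<open>Local part.\<close> If \<open>e\<close> and \<open>f\<close> are disjoint edges, the link of the face \<open>{e, f}\<close> is a finite set of
  points with the homology of the \<open>0\<close>-sphere, hence consists of two points. These two remaining
  edges cannot be disjoint, because \<open>M\<close> has dimension 2, so they form a path \<open>P\<^sub>3\<close>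
  (\<open>locally_circle_if_homology_sphere\<close>). This single condition, that deleting two disjoint edges
  together with their end vertices leaves a \<open>P\<^sub>3\<close> and that every edge lies in such a pair, determines the graph up to four
  possibilities. Deleting just one edge must leave \<open>2P\<^sub>3\<close>, \<open>C\<^sub>5\<close> or \<open>K\<^sub>3\<^sub>,\<^sub>2\<close>
  (\<open>locally_P3_classification\<close>). If \<open>2P\<^sub>3\<close> or \<open>C\<^sub>5\<close> occurs for some edge, then one component of the
  graph is a \<open>P\<^sub>3\<close>, and the rest is again one of these three graphs; if \<open>K\<^sub>3\<^sub>,\<^sub>2\<close> occurs for every
  edge, then the graph is \<open>K\<^sub>4\<^sub>,\<^sub>3\<close> (\<open>locally_circle_cases\<close>).

  \<^emph>\<open>Global part.\<close> The matching complex of \<open>K\<^sub>4\<^sub>,\<^sub>3\<close> is a triangulated torus, so links of nonempty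
  faces cannot exclude it. Its first homology does: two disjoint closed curves cut the torus
  into two annuli, and the number of signed crossings of one of the annuli is a functional that
  vanishes on boundaries but is \<open>1\<close> on a loop crossing that annulus once
  (\<open>homology_nontrivial_if_cut\<close>, \<open>homology_nontrivial_matching_complex_K43\<close>). This works over every
  field.

  In the other cases the component \<open>P\<^sub>3\<close> contributes two points and the rest of the graph a circle
  of length 4, 5 or 6, and \<open>M\<close> is the join of the two (\<open>matching_complex_bipyramid\<close>).
\<close>

section \<open>Reduced homology in low dimensions\<close>

lemma zero_in_boundaries: "0 \<in> boundaries K i"
  unfolding boundaries_def
  by (rule image_eqI[of _ _ 0]) (auto simp: boundary_def simplicial_chains_def fun_eq_iff)

lemma homology_class_self: "z \<in> homology_class K i z"
  unfolding homology_class_def using zero_in_boundaries[of K i] by force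

text \<open>
  The homology classes are cosets of the boundaries, so a cycle whose class is the class of \<open>0\<close>
  is itself a boundary.
\<close>

lemma cycle_is_boundary:
  fixes z :: "'v list \<Rightarrow> 'k::field"
  assumes "homology_trivial TYPE('k) K i" "z \<in> simplicial_cycles K i"
  shows "z \<in> boundaries K i"
proof -
  have "homology_class K i z = homology_class K i 0"
    using assms unfolding homology_trivial_def reduced_homology_def by blast
  then have "z \<in> homology_class K i 0" using homology_class_self by blast
  then show ?thesis by (auto simp: homology_class_def)
qed

text \<open>
  If \<open>0\<close> were the only cycle, the homology would be a single class, but the field has at least
  two elements.
\<close>

lemma nonzero_cycle_of_homology_one_dimensional:
  assumes "homology_one_dimensional TYPE('k::field) K i"
  shows "\<exists>z \<in> simplicial_cycles K i. z \<noteq> (0 :: 'v list \<Rightarrow> 'k)"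
proof (rule ccontr)
  assume "\<not> ?thesis"
  then have "(reduced_homology K i :: ('v list \<Rightarrow> 'k) set set) \<subseteq> {homology_class K i 0}"
    by (auto simp: reduced_homology_def)
  moreover obtain \<phi> where "bij_betw \<phi> (reduced_homology K i :: ('v list \<Rightarrow> 'k) set set) (UNIV :: 'k set)"
    using assms unfolding homology_one_dimensional_def by (elim exE conjE) (rule that)
  ultimately have "x = \<phi> (homology_class K i 0)" for x
    using bij_betw_imp_surj_on[of \<phi>] by fast
  then have "(0 :: 'k) = 1" by metis
  then show False by simp
qed

text \<open>
  This is how the homology of links gives faces: a nonzero cycle is supported on faces of the
  right size. In particular a maximal face must have full dimension.
\<close>

lemma face_of_homology_one_dimensional:
  assumes "homology_one_dimensional TYPE('k::field) K i"
  shows "\<exists>\<sigma>\<in>K. int (card \<sigma>) = i + 1"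
proof -
  obtain z :: "'a list \<Rightarrow> 'k" where z: "z \<in> simplicial_cycles K i" "z \<noteq> 0"
    using nonzero_cycle_of_homology_one_dimensional[OF assms] by blast
  then obtain xs where "z xs \<noteq> 0" by (auto simp: fun_eq_iff)
  then have "distinct xs \<and> set xs \<in> K \<and> int (length xs) = i + 1"
    using z(1) by (auto simp: simplicial_cycles_def simplicial_chains_def)
  then show ?thesis by (metis distinct_card)
qed

lemma eq_singleton_if_card_le_1: "finite A \<Longrightarrow> card A \<le> 1 \<Longrightarrow> v \<in> A \<Longrightarrow> A = {v}"
  using card_le_Suc0_iff_eq[of A] by auto

text \<open>
  A \<open>0\<close>-dimensional complex has no nonzero boundaries in degree \<open>0\<close>, and its cycles are the
  functions on the points with sum zero. They form a space of dimension one less than the number of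
  points. One point gives only the zero cycle, and three points give two differences
  \<open>[a] - [b]\<close> and \<open>[a] - [c]\<close> that are linearly independent.
\<close>

lemma two_points_of_homology:
  fixes K :: "'v set set"
  assumes fin: "finite (\<Union>K)" and dim: "\<And>\<sigma>. \<sigma> \<in> K \<Longrightarrow> finite \<sigma> \<and> card \<sigma> \<le> 1"
    and hom: "homology_one_dimensional TYPE('k::field) K 0"
  shows "card (\<Union>K) = 2"
proof -
  have sing: "{v} \<in> K" if "v \<in> \<Union>K" for v
  proof -
    from that obtain \<sigma> where "\<sigma> \<in> K" "v \<in> \<sigma>" by blast
    moreover from this dim[of \<sigma>] have "\<sigma> = {v}" by (intro eq_singleton_if_card_le_1) simp_all
    ultimately show ?thesis by simp
  qed
  have "boundaries K 0 = {0 :: 'v list \<Rightarrow> 'k}"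
  proof -
    have "c = 0" if "c \<in> simplicial_chains K 1" for c :: "'v list \<Rightarrow> 'k"
    proof -
      have "c xs = 0" for xs
      proof (rule ccontr)
        assume "c xs \<noteq> 0"
        then have "distinct xs" "set xs \<in> K" "length xs = 2"
          using that by (auto simp: simplicial_chains_def)
        then show False using dim[of "set xs"] by (simp add: distinct_card)
      qed
      then show ?thesis by (auto simp: fun_eq_iff)
    qed
    moreover have "boundary K 0 = (0 :: 'v list \<Rightarrow> 'k)" by (simp add: boundary_def fun_eq_iff)
    ultimately have "boundaries K 0 \<subseteq> {0 :: 'v list \<Rightarrow> 'k}"
      unfolding boundaries_def by force
    then show ?thesis using zero_in_boundaries[of K 0] by blast
  qed
  then have cls: "homology_class K 0 z = {z}" for z :: "'v list \<Rightarrow> 'k"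
    by (auto simp: homology_class_def)
  define diff :: "'v \<Rightarrow> 'v \<Rightarrow> 'v list \<Rightarrow> 'k" where
    "diff a b = (\<lambda>xs. (if xs = [a] then 1 else 0) - (if xs = [b] then 1 else 0))" for a b
  have diff: "diff a b \<in> simplicial_cycles K 0" if "a \<in> \<Union>K" "b \<in> \<Union>K" for a b
  proof -
    have "diff a b \<in> simplicial_chains K 0"
      unfolding simplicial_chains_def diff_def using sing that
      by (auto simp: append_eq_Cons_conv split: if_splits)
    moreover have "boundary K (diff a b) = 0"
    proof
      fix xs
      show "boundary K (diff a b) xs = 0 xs"
        using fin that by (cases "xs = []") (simp_all add: boundary_def diff_def sum_subtractf)
    qed
    ultimately show ?thesis by (simp add: simplicial_cycles_def)
  qed
  have "2 \<le> card (\<Union>K)"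
  proof (rule ccontr)
    assume "\<not> 2 \<le> card (\<Union>K)"
    then have le1: "card (\<Union>K) \<le> 1" by simp
    obtain z :: "'v list \<Rightarrow> 'k" where z: "z \<in> simplicial_cycles K 0" "z \<noteq> 0"
      using nonzero_cycle_of_homology_one_dimensional[OF hom] by blast
    then obtain xs where xs: "z xs \<noteq> 0" by (auto simp: fun_eq_iff)
    then have "set xs \<in> K" "length xs = 1"
      using z(1) by (auto simp: simplicial_cycles_def simplicial_chains_def)
    then obtain v where v: "xs = [v]" "{v} \<in> K" by (auto simp: length_Suc_conv)
    then have "v \<in> \<Union>K" by blast
    then have "\<Union>K = {v}" by (rule eq_singleton_if_card_le_1[OF fin le1])
    then have "boundary K z [] = z [v]" by (simp add: boundary_def)
    then show False using z(1) xs v by (simp add: simplicial_cycles_def)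
  qed
  moreover have "\<not> 3 \<le> card (\<Union>K)"
  proof
    assume "3 \<le> card (\<Union>K)"
    then obtain T where "T \<subseteq> \<Union>K" "card T = 3" by (meson obtain_subset_with_card_n)
    then obtain a b c where "T = {a, b, c}" "a \<noteq> b" "a \<noteq> c" "b \<noteq> c"
      unfolding card_3_iff by blast
    then have abc: "a \<in> \<Union>K" "b \<in> \<Union>K" "c \<in> \<Union>K" "a \<noteq> b" "a \<noteq> c" "b \<noteq> c"
      using \<open>T \<subseteq> \<Union>K\<close> by blast+
    obtain \<phi> :: "('v list \<Rightarrow> 'k) set \<Rightarrow> 'k" where
      inj: "inj_on \<phi> (reduced_homology K 0)" and
      scale: "\<forall>r. \<forall>z\<in>simplicial_cycles K 0. \<phi> {\<lambda>xs. r * z xs} = r * \<phi> {z}"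
      using hom unfolding homology_one_dimensional_def bij_betw_def cls
      by (elim exE conjE) (rule that)
    have cyc_scale: "(\<lambda>xs. r * z xs) \<in> simplicial_cycles K 0"
      if "z \<in> simplicial_cycles K 0" for r and z :: "'v list \<Rightarrow> 'k"
    proof -
      have "r * z (us @ x # y # vs) = - (r * z (us @ y # x # vs))" for us x y vs
      proof -
        have "z (us @ x # y # vs) = - z (us @ y # x # vs)"
          using that unfolding simplicial_cycles_def simplicial_chains_def by blast
        then show ?thesis by (simp only: mult_minus_right)
      qed
      moreover have "boundary K (\<lambda>xs. r * z xs) = 0"
      proof -
        have "boundary K z = 0" using that unfolding simplicial_cycles_def by blast
        then show ?thesis by (simp add: boundary_def fun_eq_iff sum_distrib_left[symmetric])
      qed
      moreover have "\<forall>xs. z xs \<noteq> 0 \<longrightarrow> distinct xs \<and> set xs \<in> K \<and> int (length xs) = 0 + 1"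
        using that unfolding simplicial_cycles_def simplicial_chains_def by blast
      then have "\<forall>xs. r * z xs \<noteq> 0 \<longrightarrow> distinct xs \<and> set xs \<in> K \<and> int (length xs) = 0 + 1"
        using mult_not_zero by blast
      ultimately show ?thesis unfolding simplicial_cycles_def simplicial_chains_def by blast
    qed
    have \<phi>_inj: "z = w" if "z \<in> simplicial_cycles K 0" "w \<in> simplicial_cycles K 0"
      "\<phi> {z} = \<phi> {w}" for z w :: "'v list \<Rightarrow> 'k"
      using inj that unfolding inj_on_def reduced_homology_def cls by blast
    let ?z = "diff a b" and ?w = "diff a c"
    have zw: "?z \<in> simplicial_cycles K 0" "?w \<in> simplicial_cycles K 0" using diff abc by auto
    \<comment> \<open>Both multiples have the same image under the linear bijection, so they agree; evaluate at the points.\<close>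
    have "(\<lambda>xs. \<phi> {?w} * ?z xs) = (\<lambda>xs. \<phi> {?z} * ?w xs)"
      by (rule \<phi>_inj) (simp_all add: cyc_scale zw scale)
    from fun_cong[OF this, of "[b]"] have "\<phi> {?w} = 0" using abc by (simp add: diff_def)
    moreover have "\<phi> {(\<lambda>xs. 0 * ?w xs)} = 0" using spec[OF scale, of 0, THEN bspec, OF zw(2)] by simp
    ultimately have "?w = (\<lambda>xs. 0 * ?w xs)" using \<phi>_inj[OF zw(2) cyc_scale[OF zw(2)]] by metis
    from fun_cong[OF this, of "[c]"] show False using abc by (simp add: diff_def)
  qed
  ultimately show ?thesis by linarith
qed

section \<open>A cut that detects first homology\<close>

text \<open>
  The vanishing diagonal is a separate hypothesis because in characteristic 2 it does not follow
  from antisymmetry.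
\<close>

lemma antisymmetric_sum_zero:
  fixes f :: "'b \<Rightarrow> 'b \<Rightarrow> 'k::ab_group_add"
  assumes "finite A" "\<And>x y. x \<in> A \<Longrightarrow> y \<in> A \<Longrightarrow> f x y = - f y x" "\<And>x. x \<in> A \<Longrightarrow> f x x = 0"
  shows "(\<Sum>x\<in>A. \<Sum>y\<in>A. f x y) = 0"
  using assms
proof (induction A rule: finite_induct)
  case (insert a A)
  have IH: "(\<Sum>x\<in>A. \<Sum>y\<in>A. f x y) = 0"
    by (rule insert.IH) (use insert.prems in blast)+
  have "(\<Sum>y\<in>A. f a y) + (\<Sum>x\<in>A. f x a) = (\<Sum>y\<in>A. f a y + f y a)"
    by (simp add: sum.distrib)
  also have "\<dots> = 0"
  proof (rule sum.neutral, rule ballI)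
    fix y assume "y \<in> A"
    then have "f a y = - f y a" using insert.prems(1)[of a y] by blast
    then show "f a y + f y a = 0" by simp
  qed
  finally have 0: "(\<Sum>y\<in>A. f a y) + (\<Sum>x\<in>A. f x a) = 0" .
  have "(\<Sum>x\<in>insert a A. \<Sum>y\<in>insert a A. f x y)
     = f a a + ((\<Sum>y\<in>A. f a y) + (\<Sum>x\<in>A. f x a)) + (\<Sum>x\<in>A. \<Sum>y\<in>A. f x y)"
    using insert.hyps by (simp add: sum.distrib add.assoc)
  then show ?case using IH 0 insert.prems(2)[of a] by simp
qed simp

definition point_chain :: "'v \<Rightarrow> 'v list \<Rightarrow> 'k::field"
  where "point_chain a = (\<lambda>xs. if xs = [a] then 1 else 0)"

definition edge_chain :: "'v \<Rightarrow> 'v \<Rightarrow> 'v list \<Rightarrow> 'k::field"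
  where "edge_chain a b = (\<lambda>xs. (if xs = [a, b] then 1 else 0) - (if xs = [b, a] then 1 else 0))"

lemma simplicial_chains_add:
  assumes "c \<in> simplicial_chains K i" "d \<in> simplicial_chains K i"
  shows "c + d \<in> simplicial_chains K i"
proof -
  have "(c + d) (us @ x # y # vs) = - (c + d) (us @ y # x # vs)" for us x y vs
  proof -
    have "c (us @ x # y # vs) = - c (us @ y # x # vs)" "d (us @ x # y # vs) = - d (us @ y # x # vs)"
      using assms unfolding simplicial_chains_def by blast+
    then show ?thesis by simp
  qed
  moreover have "distinct xs \<and> set xs \<in> K \<and> int (length xs) = i + 1" if "(c + d) xs \<noteq> 0" for xs
  proof -
    have "c xs \<noteq> 0 \<or> d xs \<noteq> 0" using that by auto
    then show ?thesis using assms unfolding simplicial_chains_def by blast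
  qed
  ultimately show ?thesis unfolding simplicial_chains_def by blast
qed

lemma edge_chain_in_chains:
  fixes a b :: 'v
  assumes "{a, b} \<in> K" "a \<noteq> b"
  shows "(edge_chain a b :: 'v list \<Rightarrow> 'k::field) \<in> simplicial_chains K 1"
proof -
  have *: "us @ x # y # vs = [a', b'] \<longleftrightarrow> us = [] \<and> vs = [] \<and> x = a' \<and> y = b'"
    for us vs and x y a' b' :: 'v
    by (cases us) (auto simp: append_eq_Cons_conv)
  have coeff: "edge_chain a b (us @ x # y # vs) = (if us = [] \<and> vs = [] \<and> x = a \<and> y = b then 1 else 0)
      - (if us = [] \<and> vs = [] \<and> x = b \<and> y = a then 1 else 0 :: 'k)" for us vs x y
    unfolding edge_chain_def * ..
  have "edge_chain a b (us @ x # y # vs) = - (edge_chain a b (us @ y # x # vs) :: 'k)" for us vs x y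
    unfolding coeff minus_diff_eq by (simp only: conj_commute)
  moreover have "distinct xs \<and> set xs \<in> K \<and> int (length xs) = 1 + 1"
    if "edge_chain a b xs \<noteq> (0 :: 'k)" for xs
  proof -
    have "xs = [a, b] \<or> xs = [b, a]" using that by (auto simp: edge_chain_def split: if_splits)
    then show ?thesis using assms by (auto simp: insert_commute)
  qed
  ultimately show ?thesis unfolding simplicial_chains_def by blast
qed

lemma boundary_add: "boundary K (c + d) = boundary K c + boundary K d"
  by (simp add: boundary_def fun_eq_iff sum.distrib)

lemma boundary_edge_chain:
  fixes a b :: 'v
  assumes "finite (\<Union>K)" "{a, b} \<in> K"
  shows "boundary K (edge_chain a b) = (point_chain b - point_chain a :: 'v list \<Rightarrow> 'k::field)"
proof
  fix xs
  have ab: "a \<in> \<Union>K" "b \<in> \<Union>K" using assms(2) by auto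
  have eq: "v # xs = [s, t] \<longleftrightarrow> v = s \<and> xs = [t]" for v s t :: 'v by auto
  have 1: "(\<Sum>v\<in>\<Union>K. (if v # xs = [s, t] then 1 else 0) :: 'k) = (if xs = [t] then 1 else 0)"
    if "s \<in> \<Union>K" for s t :: 'v
    using assms(1) that by (cases "xs = [t]") simp_all
  show "boundary K (edge_chain a b) xs = (point_chain b - point_chain a :: 'v list \<Rightarrow> 'k) xs"
    unfolding boundary_def edge_chain_def point_chain_def fun_diff_def sum_subtractf
      1[OF ab(1)] 1[OF ab(2)] ..
qed

text \<open>
  Think of \<open>L\<close> and \<open>R\<close> as the vertices on two disjoint curves, and of \<open>up e f\<close> as saying that the
  edge from \<open>e\<close> to \<open>f\<close> runs through a fixed one of the regions between the curves. By the hypotheses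
  \<open>left\<close> and \<open>right\<close> the two edges of a triangle that join \<open>L\<close> to \<open>R\<close> lie in the same region, so the
  net flow through that region is a cocycle. The loop \<open>e0, e1, e2, e3\<close> passes through the region only
  along the edge from \<open>e0\<close> to \<open>e1\<close>, hence it is not a boundary.
\<close>

lemma homology_nontrivial_if_cut:
  fixes K :: "'v set set"
  assumes fin: "finite L" "finite R" and V: "\<Union>K = L \<union> R" "L \<inter> R = {}"
    and left: "\<And>e e' f. e \<in> L \<Longrightarrow> e' \<in> L \<Longrightarrow> f \<in> R \<Longrightarrow> distinct [e, e', f] \<Longrightarrow> {e, e', f} \<in> K \<Longrightarrow> up e f \<longleftrightarrow> up e' f"
    and right: "\<And>e f f'. e \<in> L \<Longrightarrow> f \<in> R \<Longrightarrow> f' \<in> R \<Longrightarrow> distinct [e, f, f'] \<Longrightarrow> {e, f, f'} \<in> K \<Longrightarrow> up e f \<longleftrightarrow> up e f'"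
    and cyc: "e0 \<in> L" "e1 \<in> R" "e2 \<in> L" "e3 \<in> L" "e2 \<noteq> e3" "e3 \<noteq> e0"
      "{e0, e1} \<in> K" "{e1, e2} \<in> K" "{e2, e3} \<in> K" "{e3, e0} \<in> K"
    and cross: "up e0 e1" "\<not> up e2 e1"
  shows "\<not> homology_trivial TYPE('k::field) K 1"
proof
  assume triv: "homology_trivial TYPE('k) K 1"
  \<comment> \<open>Only the orientation from \<open>L\<close> to \<open>R\<close> is counted; summing over both would double the value and lose characteristic 2.\<close>
  define flux :: "('v list \<Rightarrow> 'k) \<Rightarrow> 'k" where
    "flux c = (\<Sum>e\<in>L. \<Sum>f\<in>R. if up e f then c [e, f] else 0)" for c
  have flux_add: "flux (c + d) = flux c + flux d" for c d
    unfolding flux_def sum.distrib[symmetric] by (intro sum.cong) auto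
  have flux_boundary: "flux (boundary K c) = 0" if c: "c \<in> simplicial_chains K 2" for c
  proof -
    have supp: "distinct xs \<and> set xs \<in> K" if "c xs \<noteq> 0" for xs
      using c that unfolding simplicial_chains_def by blast
    have alt: "c (us @ x # y # vs) = - c (us @ y # x # vs)" for us x y vs
      using c unfolding simplicial_chains_def by blast
    have swap1: "c [v, e, f] = - c [e, v, f]" for v e f
      using alt[of "[]" v e "[f]"] by (simp only: append.simps)
    have swap2: "c [v, e, f] = - c [v, f, e]" for v e f
      using alt[of "[v]" e f "[]"] by (simp only: append.simps)
    have swap13: "c [v, e, f] = - c [f, e, v]" for v e f
      unfolding swap1[of v e f] swap2[of e v f] swap1[of e f v] by simp
    have dist0: "c [v, e, f] = 0" if "v = e \<or> v = f \<or> e = f" for v e f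
      using supp[of "[v, e, f]"] that by auto
    have "flux (boundary K c) = (\<Sum>e\<in>L. \<Sum>f\<in>R. \<Sum>v\<in>L \<union> R. if up e f then c [v, e, f] else 0)"
      unfolding flux_def boundary_def V(1) by (intro sum.cong) auto
    also have "\<dots> = (\<Sum>e\<in>L. \<Sum>f\<in>R. (\<Sum>v\<in>L. if up e f then c [v, e, f] else 0) +
        (\<Sum>v\<in>R. if up e f then c [v, e, f] else 0))"
      by (intro sum.cong refl sum.union_disjoint fin V(2))
    also have "\<dots> = (\<Sum>e\<in>L. \<Sum>f\<in>R. \<Sum>v\<in>L. if up e f then c [v, e, f] else 0) +
        (\<Sum>e\<in>L. \<Sum>f\<in>R. \<Sum>v\<in>R. if up e f then c [v, e, f] else 0)"
      by (simp only: sum.distrib)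
    \<comment> \<open>A triangle with two vertices in \<open>L\<close> occurs once for each of its crossing edges, with opposite signs.\<close>
    also have "(\<Sum>e\<in>L. \<Sum>f\<in>R. \<Sum>v\<in>L. if up e f then c [v, e, f] else 0)
        = (\<Sum>f\<in>R. \<Sum>e\<in>L. \<Sum>v\<in>L. if up e f then c [v, e, f] else 0)"
      by (rule sum.swap)
    also have "\<dots> = 0"
    proof (rule sum.neutral, rule ballI, rule antisymmetric_sum_zero[OF fin(1)])
      fix f e v assume f: "f \<in> R" and e: "e \<in> L" and v: "v \<in> L"
      show "(if up e f then c [v, e, f] else 0) = - (if up v f then c [e, v, f] else 0)"
      proof (cases "c [e, v, f] = 0")
        case True
        then show ?thesis using swap1[of v e f] by simp
      next
        case False
        then have "up e f \<longleftrightarrow> up v f"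
          using supp[of "[e, v, f]"] by (intro left[OF e v f]) auto
        then show ?thesis using swap1[of v e f] by simp
      qed
    qed (simp add: dist0)
    also have "(\<Sum>e\<in>L. \<Sum>f\<in>R. \<Sum>v\<in>R. if up e f then c [v, e, f] else 0) = 0"
    proof (rule sum.neutral, rule ballI, rule antisymmetric_sum_zero[OF fin(2)])
      fix e f v assume e: "e \<in> L" and f: "f \<in> R" and v: "v \<in> R"
      show "(if up e f then c [v, e, f] else 0) = - (if up e v then c [f, e, v] else 0)"
      proof (cases "c [f, e, v] = 0")
        case True
        then show ?thesis using swap13[of v e f] by simp
      next
        case False
        then have "up e f \<longleftrightarrow> up e v"
          using supp[of "[f, e, v]"] by (intro right[OF e f v]) (auto simp: insert_commute)
        then show ?thesis using swap13[of v e f] by simp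
      qed
    qed (simp add: dist0)
    finally show ?thesis by simp
  qed
  have ne: "e0 \<noteq> e1" "e1 \<noteq> e2" using cyc V(2) by auto
  define z :: "'v list \<Rightarrow> 'k"
    where "z = edge_chain e0 e1 + edge_chain e1 e2 + edge_chain e2 e3 + edge_chain e3 e0"
  have finV: "finite (\<Union>K)" using fin V(1) by simp
  have "z \<in> simplicial_chains K 1"
    unfolding z_def by (intro simplicial_chains_add edge_chain_in_chains cyc ne)
  moreover have "boundary K z = 0"
    unfolding z_def boundary_add boundary_edge_chain[OF finV cyc(7)]
      boundary_edge_chain[OF finV cyc(8)] boundary_edge_chain[OF finV cyc(9)]
      boundary_edge_chain[OF finV cyc(10)]
    by simp
  ultimately have "z \<in> simplicial_cycles K 1" by (simp add: simplicial_cycles_def)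
  from cycle_is_boundary[OF triv this] obtain c where
    "c \<in> simplicial_chains K 2" "z = boundary K c"
    by (auto simp: boundaries_def)
  then have "flux z = 0" using flux_boundary by blast
  moreover have "flux (edge_chain e0 e1) = 1"
  proof -
    have 1: "(if up e f then edge_chain e0 e1 [e, f] else 0 :: 'k) = (if f = e1 then if e = e0 then 1 else 0 else 0)"
      if ef: "e \<in> L" "f \<in> R" for e f
    proof -
      have "f \<noteq> e0" using ef(2) V(2) cyc(1) by blast
      then show ?thesis using cross(1) by (cases "e = e0"; cases "f = e1") (simp_all add: edge_chain_def)
    qed
    have "flux (edge_chain e0 e1) = (\<Sum>e\<in>L. \<Sum>f\<in>R. if f = e1 then if e = e0 then 1 else 0 else 0)"
      unfolding flux_def by (intro sum.cong refl 1)
    then show ?thesis using fin cyc(1,2) by simp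
  qed
  moreover have vanish: "flux (edge_chain a b) = 0"
    if sep: "\<And>e f. e \<in> L \<Longrightarrow> f \<in> R \<Longrightarrow> up e f \<Longrightarrow> [e, f] \<noteq> [a, b] \<and> [e, f] \<noteq> [b, a]" for a b
  proof -
    have "(if up e f then edge_chain a b [e, f] else 0 :: 'k) = 0" if ef: "e \<in> L" "f \<in> R" for e f
    proof (cases "up e f")
      case True
      with ef have "[e, f] \<noteq> [a, b] \<and> [e, f] \<noteq> [b, a]" by (rule sep)
      then show ?thesis by (simp only: edge_chain_def if_False diff_self if_cancel)
    qed simp
    then show ?thesis unfolding flux_def by (simp only: sum.neutral_const cong: sum.cong)
  qed
  have "e2 \<notin> R" "e3 \<notin> R" "e0 \<notin> R" using V(2) cyc(1,3,4) by auto
  then have "flux (edge_chain e1 e2) = 0" "flux (edge_chain e2 e3) = 0" "flux (edge_chain e3 e0) = 0"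
    using cross(2) by (intro vanish; metis list.inject)+
  ultimately show False by (simp add: z_def flux_add)
qed

section \<open>Graphs in which deleting an edge with its ends leaves a path with two edges\<close>

text \<open>
  A graph without isolated vertices is determined by its edges, and so are its matchings. From here on
  graphs are sets of edges, and deleting vertices removes the edges that meet them.
\<close>

definition delete_verts :: "'a set set \<Rightarrow> 'a set \<Rightarrow> 'a set set" (infixl "\<ominus>" 70)
  where "E \<ominus> S = {e \<in> E. e \<inter> S = {}}"

lemma delete_verts_mono: "E \<subseteq> F \<Longrightarrow> E \<ominus> S \<subseteq> F \<ominus> S"
  by (auto simp: delete_verts_def)

lemma delete_verts_insert:
  "insert e E \<ominus> S = (if e \<inter> S = {} then insert e (E \<ominus> S) else E \<ominus> S)"
  by (auto simp: delete_verts_def)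

lemma delete_verts_empty: "{} \<ominus> S = {}"
  by (simp add: delete_verts_def)

definition is_P3 :: "'a set set \<Rightarrow> bool"
  where "is_P3 E \<longleftrightarrow> (\<exists>x y z. distinct [x, y, z] \<and> E = {{x, y}, {y, z}})"

text \<open>
  In terms of the matching complex: every vertex has exactly two neighbours, and these are not
  adjacent, so the complex is a disjoint union of circles.
\<close>

definition locally_P3 :: "'a set set \<Rightarrow> bool"
  where "locally_P3 B \<longleftrightarrow> B \<noteq> {} \<and> (\<forall>e\<in>B. card e = 2) \<and> (\<forall>e\<in>B. is_P3 (B \<ominus> e))"

definition is_2P3 :: "'a set set \<Rightarrow> bool"
  where "is_2P3 B \<longleftrightarrow> (\<exists>x1 x x2 y1 y y2. distinct [x1, x, x2, y1, y, y2] \<and>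
           B = {{x1, x}, {x, x2}, {y1, y}, {y, y2}})"

definition is_C5 :: "'a set set \<Rightarrow> bool"
  where "is_C5 B \<longleftrightarrow> (\<exists>a b c d e. distinct [a, b, c, d, e] \<and>
           B = {{a, b}, {b, c}, {c, d}, {d, e}, {e, a}})"

definition is_K32 :: "'a set set \<Rightarrow> bool"
  where "is_K32 B \<longleftrightarrow> (\<exists>x y z a b. distinct [x, y, z, a, b] \<and>
           B = {{x, a}, {y, a}, {z, a}, {x, b}, {y, b}, {z, b}})"

lemma is_P3_containing_edgeE:
  assumes "is_P3 F" "{a, b} \<in> F"
  obtains p q s where "{p, q} = {a, b}" "distinct [p, q, s]" "F = {{q, p}, {p, s}}"
proof -
  obtain x y z where *: "distinct [x, y, z]" "F = {{x, y}, {y, z}}"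
    using assms(1) by (auto simp: is_P3_def)
  consider "{a, b} = {x, y}" | "{a, b} = {y, z}" using * assms(2) by auto
  then show ?thesis
  proof cases
    case 1
    show ?thesis by (rule that[of y x z]) (use * 1 in auto)
  next
    case 2
    show ?thesis by (rule that[of y z x]) (use * 2 in auto)
  qed
qed

lemma is_P3_two:
  assumes "is_P3 F" shows "\<exists>e f. e \<in> F \<and> f \<in> F \<and> e \<noteq> f"
  using assms unfolding is_P3_def by (auto simp: doubleton_eq_iff)

lemma not_is_P3_if_subset: "F \<subseteq> {e} \<Longrightarrow> \<not> is_P3 F"
  by (auto dest!: is_P3_two)

text \<open>
  Fix an edge and the path \<open>x - y - z\<close> that its deletion leaves. Deleting \<open>x - y\<close> or \<open>y - z\<close>
  instead leaves the fixed edge and one more edge, so everything is known except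
  which of the two possible edges between \<open>y\<close> and the fixed edge exist. The three graphs arise according to where the additional edges end.
\<close>

lemma locally_P3_classification:
  assumes "locally_P3 B"
  shows "is_2P3 B \<or> is_C5 B \<or> is_K32 B"
proof -
  have c2: "card e = 2" if "e \<in> B" for e using assms that by (auto simp: locally_P3_def)
  have P: "is_P3 (B \<ominus> {a, b})" if "{a, b} \<in> B" for a b
    using assms that by (auto simp: locally_P3_def)
  obtain a b where ab: "{a, b} \<in> B"
    using assms c2 unfolding locally_P3_def by (metis card_2_iff ex_in_conv)
  obtain x y z where xyz: "distinct [x, y, z]" "B \<ominus> {a, b} = {{x, y}, {y, z}}"
    using P[OF ab] unfolding is_P3_def by blast
  have ne: "{x, y, z} \<inter> {a, b} = {}" "{x, y} \<in> B" "{y, z} \<in> B"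
  proof -
    have "{x, y} \<in> B \<ominus> {a, b}" "{y, z} \<in> B \<ominus> {a, b}" using xyz(2) by auto
    then show "{x, y, z} \<inter> {a, b} = {}" "{x, y} \<in> B" "{y, z} \<in> B"
      unfolding delete_verts_def by auto
  qed
  have "{a, b} \<in> B \<ominus> {x, y}" using ab ne by (auto simp: delete_verts_def)
  from is_P3_containing_edgeE[OF P[OF ne(2)] this] obtain p q s
    where pqs: "{p, q} = {a, b}" "distinct [p, q, s]" "B \<ominus> {x, y} = {{q, p}, {p, s}}" .
  have pq: "{p, q} \<in> B" "B \<ominus> {p, q} = {{x, y}, {y, z}}" "{p, s} \<in> B" "{q, p} \<in> B"
  proof -
    have "{p, s} \<in> B \<ominus> {x, y}" using pqs(3) by auto
    then show "{p, s} \<in> B" unfolding delete_verts_def by simp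
    show "{p, q} \<in> B" "B \<ominus> {p, q} = {{x, y}, {y, z}}" using pqs(1) ab xyz by simp_all
    then show "{q, p} \<in> B" by (simp add: insert_commute)
  qed
  have d1: "{x, y, z} \<inter> {p, q} = {}" using ne pqs(1) by auto
  have s1: "s \<noteq> x" "s \<noteq> y"
  proof -
    have "{p, s} \<in> B \<ominus> {x, y}" using pqs(3) by auto
    then show "s \<noteq> x" "s \<noteq> y" unfolding delete_verts_def by auto
  qed
  have "{p, q} \<in> B \<ominus> {y, z}" using pq d1 by (auto simp: delete_verts_def)
  from is_P3_containing_edgeE[OF P[OF ne(3)] this] obtain p' q' t
    where pqt: "{p', q'} = {p, q}" "distinct [p', q', t]" "B \<ominus> {y, z} = {{q', p'}, {p', t}}" .
  have t1: "t \<noteq> y" "t \<noteq> z" "{p', t} \<in> B"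
  proof -
    have "{p', t} \<in> B \<ominus> {y, z}" using pqt(3) by auto
    then show "t \<noteq> y" "t \<noteq> z" "{p', t} \<in> B" unfolding delete_verts_def by auto
  qed
  \<comment> \<open>Consider the other end of an edge that meets \<open>pq\<close>: if it is \<open>y\<close>, the edge is one of the first two; if it is \<open>x\<close>, the edge avoids \<open>yz\<close>; otherwise it avoids \<open>xy\<close>.\<close>
  have sub: "B \<subseteq> {{y, p}, {y, q}, {x, y}, {y, z}, {p, q}, {p, s}, {p', t}}"
  proof
    fix e assume e: "e \<in> B"
    show "e \<in> {{y, p}, {y, q}, {x, y}, {y, z}, {p, q}, {p, s}, {p', t}}"
    proof (cases "e \<inter> {p, q} = {}")
      case True
      then have "e \<in> B \<ominus> {p, q}" using e by (simp add: delete_verts_def)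
      then show ?thesis using pq(2) by auto
    next
      case False
      then obtain v where v: "v \<in> e" "v = p \<or> v = q" by auto
      obtain w where vw: "e = {v, w}" "v \<noteq> w"
        using c2[OF e] v(1) by (auto simp: card_2_iff)
      consider "w = y" | "w = x" | "w \<noteq> x" "w \<noteq> y" by blast
      then show ?thesis
      proof cases
        case 1
        then show ?thesis using vw v(2) by (auto simp: insert_commute)
      next
        case 2
        then have "e \<in> B \<ominus> {y, z}" using e vw v(2) d1 xyz(1) by (auto simp: delete_verts_def)
        then have "e = {q', p'} \<or> e = {p', t}" using pqt(3) by auto
        then show ?thesis using pqt(1) by (metis insert_commute insert_iff)
      next
        case 3
        then have "e \<in> B \<ominus> {x, y}" using e vw v(2) d1 by (auto simp: delete_verts_def)
        then have "e = {q, p} \<or> e = {p, s}" using pqs(3) by auto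
        then show ?thesis by (metis insert_commute insert_iff)
      qed
    qed
  qed
  have PB: False if "{v, w} \<in> B" "B \<ominus> {v, w} \<subseteq> {e}" for v w e
    using P[OF that(1)] not_is_P3_if_subset[OF that(2)] by blast
  note del = delete_verts_insert delete_verts_empty
  have p'q': "(p' = p \<and> q' = q) \<or> (p' = q \<and> q' = p)" using pqt(1) by (auto simp: doubleton_eq_iff)
  show ?thesis
  proof (cases "s = z")
    case False
    \<comment> \<open>The extra edge avoids both halves of the path, so both deletions find the same one: the result is \<open>2P\<^sub>3\<close>.\<close>
    have "{p, s} \<in> B \<ominus> {y, z}" using pq(3) s1 False d1 by (auto simp: delete_verts_def)
    then have "{p, s} = {q', p'} \<or> {p, s} = {p', t}" unfolding pqt(3) by simp
    then have ts: "p' = p" "q' = q" "t = s"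
      using p'q' pqs(2) by (auto simp: doubleton_eq_iff)
    have "{y, p} \<notin> B"
      by (rule notI, rule PB[of y p "{}"], assumption) (rule order.trans[OF delete_verts_mono[OF sub]], simp add: del ts)
    moreover have "{y, q} \<notin> B"
      by (rule notI, rule PB[of y q "{p, s}"], assumption) (rule order.trans[OF delete_verts_mono[OF sub]], simp add: del ts)
    ultimately have "B \<subseteq> {{x, y}, {y, z}, {p, q}, {p, s}}"
      using sub unfolding ts by (simp only: subset_insert insert_absorb2 simp_thms)
    then have "B = {{x, y}, {y, z}, {q, p}, {p, s}}"
      unfolding insert_commute[of q p "{}"] by (rule subset_antisym) (simp add: ne pq)
    moreover have "distinct [x, y, z, q, p, s]" using xyz(1) d1 pqs(2) s1 False by auto
    ultimately show ?thesis unfolding is_2P3_def by blast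
  next
    case True
    have tx: "t = x"
    proof (rule ccontr)
      assume "t \<noteq> x"
      then have "{p', t} \<in> B \<ominus> {x, y}" using t1 d1 p'q' by (auto simp: delete_verts_def)
      then have "{p', t} = {q, p} \<or> {p', t} = {p, s}" unfolding pqs(3) by simp
      then show False using p'q' pqs(2) pqt(2) True t1 by (auto simp: doubleton_eq_iff)
    qed
    show ?thesis
    proof (cases "p' = p")
      case True
      have y: "{y, p} \<notin> B"
        by (rule notI, rule PB[of y p "{}"], assumption) (rule order.trans[OF delete_verts_mono[OF sub]], simp add: del True)
      have "{y, q} \<in> B"
      proof (rule ccontr)
        assume "{y, q} \<notin> B"
        then have "B \<subseteq> {{x, y}, {y, z}, {p, q}, {p, s}, {p', t}}" using sub y by (simp only: subset_insert simp_thms)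
        from delete_verts_mono[OF this, of "{p, s}"] have "B \<ominus> {p, s} \<subseteq> {{x, y}}"
          using d1 xyz(1) xyz(1)[THEN distinct_rev[THEN iffD2]] \<open>s = z\<close> tx True by (simp add: del)
        then show False using PB pq by blast
      qed
      moreover have "B \<subseteq> {{y, q}, {x, y}, {y, z}, {p, q}, {p, z}, {p, x}}"
        using y sub unfolding True tx \<open>s = z\<close> by (simp only: subset_insert simp_thms)
      ultimately have "B = {{x, p}, {z, p}, {q, p}, {x, y}, {z, y}, {q, y}}"
        using ne(2,3) pq(1,3) t1(3) unfolding True tx \<open>s = z\<close>
        by (auto simp only: insert_commute)
      moreover have "distinct [x, z, q, p, y]" using xyz(1) d1 pqs(2) \<open>s = z\<close> by auto
      ultimately show ?thesis unfolding is_K32_def by blast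
    next
      case False
      then have pp: "p' = q" "q' = p" using p'q' by auto
      have "{y, p} \<notin> B"
        by (rule notI, rule PB[of y p "{q, t}"], assumption) (rule order.trans[OF delete_verts_mono[OF sub]], simp add: del pp)
      moreover have "{y, q} \<notin> B"
        by (rule notI, rule PB[of y q "{p, s}"], assumption) (rule order.trans[OF delete_verts_mono[OF sub]], simp add: del pp)
      ultimately have "B \<subseteq> {{x, y}, {y, z}, {p, q}, {p, z}, {q, x}}"
        using sub unfolding pp tx \<open>s = z\<close> by (simp only: subset_insert simp_thms)
      then have "B = {{p, q}, {q, x}, {x, y}, {y, z}, {z, p}}"
        using ne(2,3) pq(1,3) t1(3) unfolding pp tx \<open>s = z\<close>
        by (auto simp only: insert_commute)
      moreover have "distinct [p, q, x, y, z]" using xyz(1) d1 pqs(2) \<open>s = z\<close> by auto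
      ultimately show ?thesis unfolding is_C5_def by blast
    qed
  qed
qed

section \<open>Graphs in which deleting two disjoint edges with their ends leaves a path with two edges\<close>

lemma delete_verts_delete_verts: "E \<ominus> S \<ominus> T = E \<ominus> (S \<union> T)"
  by (auto simp: delete_verts_def)

lemma in_delete_verts: "e \<in> E \<ominus> S \<longleftrightarrow> e \<in> E \<and> e \<inter> S = {}"
  by (auto simp: delete_verts_def)

text \<open>
  The property of the edge set on which the classification rests: in the matching complex the link
  of every vertex is a circle, so the complex is a closed surface.
\<close>

definition locally_circle :: "'a set set \<Rightarrow> bool"
  where "locally_circle E \<longleftrightarrow> E \<noteq> {} \<and> (\<forall>e\<in>E. card e = 2) \<and> (\<forall>e\<in>E. locally_P3 (E \<ominus> e))"

definition complete_bip :: "'a set \<Rightarrow> 'a set \<Rightarrow> 'a set set"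
  where "complete_bip X A = {{x, a} | x a. x \<in> X \<and> a \<in> A}"

definition is_P3_plus_circle :: "'a set set \<Rightarrow> bool"
  where "is_P3_plus_circle E \<longleftrightarrow> (\<exists>x y z R. distinct [x, y, z] \<and> {x, y, z} \<inter> \<Union>R = {} \<and>
           E = {{x, y}, {y, z}} \<union> R \<and> (is_2P3 R \<or> is_C5 R \<or> is_K32 R))"

lemma locally_circle_P3:
  assumes "locally_circle E" "{a, b} \<in> E" "{c, d} \<in> E" "{a, b} \<inter> {c, d} = {}"
  shows "is_P3 (E \<ominus> {a, b, c, d})"
proof -
  have "locally_P3 (E \<ominus> {a, b})" using assms by (auto simp: locally_circle_def)
  moreover have "{c, d} \<in> E \<ominus> {a, b}" using assms by (auto simp: in_delete_verts)
  ultimately have "is_P3 (E \<ominus> {a, b} \<ominus> {c, d})" unfolding locally_P3_def by blast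
  moreover have "{a, b} \<union> {c, d} = {a, b, c, d}" by auto
  ultimately show ?thesis by (simp only: delete_verts_delete_verts)
qed

lemma locally_circle_edgeE:
  assumes "locally_circle E" "e \<in> E" "p \<in> e"
  obtains w where "e = {p, w}" "w \<noteq> p"
proof -
  have "card e = 2" using assms by (auto simp: locally_circle_def)
  then obtain s t where "e = {s, t}" "s \<noteq> t" by (meson card_2_iff)
  then show ?thesis using that assms(3) by (metis insert_commute insert_iff singletonD)
qed

text \<open>
  Once a \<open>P\<^sub>3\<close> splits off, deleting one of its edges leaves exactly the rest of the graph, which is
  then covered by the classification of the preceding part.
\<close>

lemma is_P3_plus_circleI:
  assumes E: "locally_circle E" and d: "distinct [x, y, z]" "{x, y} \<in> E" "{y, z} \<in> E"
    and only: "\<And>e. e \<in> E \<Longrightarrow> e \<inter> {x, y, z} \<noteq> {} \<Longrightarrow> e = {x, y} \<or> e = {y, z}"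
  shows "is_P3_plus_circle E"
proof -
  define R where "R = E \<ominus> {x, y}"
  have "is_2P3 R \<or> is_C5 R \<or> is_K32 R"
    unfolding R_def by (rule locally_P3_classification) (use E d in \<open>auto simp: locally_circle_def\<close>)
  moreover have R: "e \<in> R \<longleftrightarrow> e \<in> E \<and> e \<inter> {x, y, z} = {}" for e
  proof
    assume e: "e \<in> R"
    then have "e \<in> E" "e \<inter> {x, y} = {}" by (auto simp: R_def in_delete_verts)
    moreover from this have "e \<noteq> {x, y}" "e \<noteq> {y, z}" by auto
    ultimately show "e \<in> E \<and> e \<inter> {x, y, z} = {}" using only[of e] by blast
  qed (auto simp: R_def in_delete_verts)
  then have "{x, y, z} \<inter> \<Union>R = {}" by blast
  moreover have "e \<in> E \<longleftrightarrow> e = {x, y} \<or> e = {y, z} \<or> e \<in> R" for e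
    using R[of e] only[of e] d by blast
  then have "E = {{x, y}, {y, z}} \<union> R" by blast
  ultimately show ?thesis using d(1) unfolding is_P3_plus_circle_def by blast
qed

text \<open>
  If \<open>ab\<close>, \<open>cd\<close> and \<open>uv\<close> are disjoint, the path left by \<open>ab\<close> and \<open>cd\<close> consists of \<open>uv\<close> and exactly
  one further edge \<open>ps\<close>, attached at an end \<open>p\<close> of \<open>uv\<close>. All cases below locate this edge.
\<close>

lemma third_edge:
  assumes E: "locally_circle E" and e: "{a, b} \<in> E" "{c, d} \<in> E" "{u, v} \<in> E"
    and dis: "{a, b} \<inter> {c, d} = {}" "{u, v} \<inter> {a, b, c, d} = {}"
  obtains p q s where "{p, q} = {u, v}" "distinct [p, q, s]" "s \<notin> {a, b, c, d}"
    "\<And>g. g \<in> E \<Longrightarrow> g \<inter> {a, b, c, d} = {} \<Longrightarrow> g = {u, v} \<or> g = {p, s}" "{p, s} \<in> E"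
proof -
  have "{u, v} \<in> E \<ominus> {a, b, c, d}" using e(3) dis(2) by (simp add: in_delete_verts)
  from is_P3_containing_edgeE[OF locally_circle_P3[OF E e(1,2) dis(1)] this]
  obtain p q s where *: "{p, q} = {u, v}" "distinct [p, q, s]"
    "E \<ominus> {a, b, c, d} = {{q, p}, {p, s}}" .
  have mem: "g \<in> E \<and> g \<inter> {a, b, c, d} = {} \<longleftrightarrow> g = {q, p} \<or> g = {p, s}" for g
    using *(3) in_delete_verts[of g E "{a, b, c, d}"] by auto
  have qp: "{q, p} = {u, v}" using *(1) by (simp add: insert_commute)
  show ?thesis
  proof (rule that[OF *(1,2)])
    show "s \<notin> {a, b, c, d}" "{p, s} \<in> E" using mem[of "{p, s}"] by auto
    show "g = {u, v} \<or> g = {p, s}" if "g \<in> E" "g \<inter> {a, b, c, d} = {}" for g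
      using mem[of g] that qp by blast
  qed
qed

text \<open>
  The form in which most contradictions appear: some pair of disjoint edges leaves at most one edge.
\<close>

lemma no_single_remainder:
  assumes E: "locally_circle E" and e: "{a, b} \<in> E" "{c, d} \<in> E" "{a, b} \<inter> {c, d} = {}"
    and "\<And>g. g \<in> E \<Longrightarrow> g \<inter> {a, b, c, d} = {} \<Longrightarrow> g = h"
  shows False
proof -
  have "E \<ominus> {a, b, c, d} \<subseteq> {h}" using assms(5) unfolding delete_verts_def by blast
  then show False using not_is_P3_if_subset locally_circle_P3[OF E e] by blast
qed

text \<open>
  The third edge at \<open>uv\<close> found for the pair \<open>x1x\<close>, \<open>y1y\<close> avoids both \<open>y1\<close> and \<open>y2\<close>, hence it is also the
  one found for the pair \<open>x1x\<close>, \<open>yy2\<close>. So neither \<open>y1\<close> nor \<open>y2\<close> is joined to \<open>uv\<close>. An edge from \<open>uv\<close> to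
  \<open>y\<close> would, together with \<open>x1x\<close>, leave only that third edge. Thus \<open>y1 - y - y2\<close> is a component.
\<close>

lemma P3_plus_circle_if_2P3_aux:
  assumes E: "locally_circle E" and uv: "{u, v} \<in> E"
    and d: "distinct [x1, x, x2, y1, y, y2]"
    and H: "E \<ominus> {u, v} = {{x1, x}, {x, x2}, {y1, y}, {y, y2}}"
    and ps: "p \<in> {u, v}" "s \<notin> {x1, x, y1, y, y2}"
    and only: "\<And>g. g \<in> E \<Longrightarrow> g \<inter> {x1, x, y1, y} = {} \<Longrightarrow> g = {u, v} \<or> g = {p, s}" "{p, s} \<in> E"
      "s \<notin> {u, v}"
  shows "is_P3_plus_circle E"
proof -
  have Hmem: "e \<in> E \<and> e \<inter> {u, v} = {} \<longleftrightarrow> e \<in> {{x1, x}, {x, x2}, {y1, y}, {y, y2}}" for e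
    using in_delete_verts[of e E "{u, v}"] H by simp
  have inE: "{x1, x} \<in> E" "{y1, y} \<in> E" "{y, y2} \<in> E" "{x, x2} \<in> E"
    and dis: "{u, v} \<inter> {x1, x, x2, y1, y, y2} = {}"
    using Hmem[of "{x1, x}"] Hmem[of "{x, x2}"] Hmem[of "{y1, y}"] Hmem[of "{y, y2}"] by auto
  obtain p' q' s' where *: "s' \<notin> {x1, x, y, y2}"
    "\<And>g. g \<in> E \<Longrightarrow> g \<inter> {x1, x, y, y2} = {} \<Longrightarrow> g = {u, v} \<or> g = {p', s'}"
    by (rule third_edge[OF E inE(1,3) uv]) (use d dis in auto)
  have "{p, s} = {u, v} \<or> {p, s} = {p', s'}"
    by (rule *(2)[OF only(2)]) (use ps dis in auto)
  then have ps': "{p, s} = {p', s'}" using only(3) by auto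
  have noY: "{r, w} \<notin> E" if "r \<in> {u, v}" "w \<in> {y1, y2}" for r w
  proof
    assume rw: "{r, w} \<in> E"
    have "{r, w} = {u, v} \<or> {r, w} = {p, s}"
    proof (cases "w = y1")
      case True
      have "{r, w} = {u, v} \<or> {r, w} = {p', s'}"
        by (rule *(2)[OF rw]) (use that(1) True dis d in auto)
      then show ?thesis using ps' by simp
    next
      case False
      then show ?thesis by (intro only(1)[OF rw]) (use that dis d in auto)
    qed
    moreover have "w \<noteq> u" "w \<noteq> v" "w \<noteq> p" "w \<noteq> s" using that ps dis by auto
    ultimately show False by auto
  qed
  have noy: "{r, y} \<notin> E" if r: "r \<in> {u, v}" for r
  proof
    assume ry: "{r, y} \<in> E"
    show False
    proof (rule no_single_remainder[OF E ry inE(1)])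
      show "{r, y} \<inter> {x1, x} = {}" using r d dis by auto
      fix g assume g: "g \<in> E" "g \<inter> {r, y, x1, x} = {}"
      have "g \<inter> {u, v} \<noteq> {}"
      proof
        assume "g \<inter> {u, v} = {}"
        then have "g \<in> {{x1, x}, {x, x2}, {y1, y}, {y, y2}}" using Hmem[of g] g(1) by blast
        then show False using g(2) by auto
      qed
      then obtain t where t: "t \<in> g" "t \<in> {u, v}" by blast
      obtain w where w: "g = {t, w}" using locally_circle_edgeE[OF E g(1) t(1)] .
      have "w \<noteq> y1" using noY[of t y1] t(2) w g(1) by blast
      then have "g \<inter> {x1, x, y1, y} = {}" using g(2) w t(2) dis by auto
      then have "g = {u, v} \<or> g = {p, s}" by (rule only(1)[OF g(1)])
      then show "g = {p, s}" using g(2) r by auto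
    qed
  qed
  show ?thesis
  proof (rule is_P3_plus_circleI[OF E, of y1 y y2])
    fix e assume e: "e \<in> E" "e \<inter> {y1, y, y2} \<noteq> {}"
    have "e \<inter> {u, v} = {}"
    proof (rule ccontr)
      assume "e \<inter> {u, v} \<noteq> {}"
      then obtain t where t: "t \<in> e" "t \<in> {u, v}" by blast
      obtain w where w: "e = {t, w}" using locally_circle_edgeE[OF E e(1) t(1)] .
      then have "w \<in> {y1, y, y2}" using e(2) t(2) dis by auto
      then show False using noy[of t] noY[of t w] t(2) w e(1) by auto
    qed
    then have "e \<in> {{x1, x}, {x, x2}, {y1, y}, {y, y2}}" using Hmem[of e] e(1) by blast
    then show "e = {y1, y} \<or> e = {y, y2}" using e(2) d by auto
  qed (use d inE in auto)
qed

text \<open>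
  The third edge cannot end at both \<open>x2\<close> and \<open>y2\<close>, so the auxiliary lemma applies to one of the two
  paths.
\<close>

lemma P3_plus_circle_if_2P3:
  assumes E: "locally_circle E" and uv: "{u, v} \<in> E" and H: "is_2P3 (E \<ominus> {u, v})"
  shows "is_P3_plus_circle E"
proof -
  obtain x1 x x2 y1 y y2 where d: "distinct [x1, x, x2, y1, y, y2]"
    and H: "E \<ominus> {u, v} = {{x1, x}, {x, x2}, {y1, y}, {y, y2}}"
    using H unfolding is_2P3_def by (elim exE conjE) (rule that)
  have "{x1, x} \<in> E \<ominus> {u, v}" "{y1, y} \<in> E \<ominus> {u, v}" using H by auto
  then have inE: "{x1, x} \<in> E" "{y1, y} \<in> E" "{u, v} \<inter> {x1, x, y1, y} = {}"
    by (auto simp: in_delete_verts)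
  obtain p q s where *: "{p, q} = {u, v}" "distinct [p, q, s]" "s \<notin> {x1, x, y1, y}"
    "\<And>g. g \<in> E \<Longrightarrow> g \<inter> {x1, x, y1, y} = {} \<Longrightarrow> g = {u, v} \<or> g = {p, s}" "{p, s} \<in> E"
    by (rule third_edge[OF E inE(1,2) uv]) (use d inE in auto)
  have p: "p \<in> {u, v}" "s \<notin> {u, v}" using *(1)[symmetric] *(2) by auto
  show ?thesis
  proof (cases "s = y2")
    case False
    show ?thesis
      by (rule P3_plus_circle_if_2P3_aux[OF E uv d H p(1) _ *(4,5) p(2)]) (use *(3) False in auto)
  next
    case True
    show ?thesis
      by (rule P3_plus_circle_if_2P3_aux[OF E uv, of y1 y y2 x1 x x2 p s])
        (use d H p True * in \<open>auto simp: insert_commute\<close>)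
  qed
qed

text \<open>
  Deleting four consecutive vertices of the cycle leaves \<open>uv\<close> and one third edge, which either ends
  outside the cycle or at the fifth vertex. If it ends outside once, it is the same edge for all five
  deletions, and it forms a component \<open>P\<^sub>3\<close> with \<open>uv\<close>. Otherwise every vertex of the cycle is joined to
  exactly one of \<open>u\<close> and \<open>v\<close>. Vertices at distance two are joined to the same one, hence, as 5 is odd,
  all of them are, and then a suitable pair of disjoint edges leaves only one edge.
\<close>

lemma P3_plus_circle_if_C5:
  assumes E: "locally_circle E" and uv: "{u, v} \<in> E" and H: "is_C5 (E \<ominus> {u, v})"
  shows "is_P3_plus_circle E"
proof -
  define cyc where "cyc c0 c1 c2 c3 c4 \<longleftrightarrow> distinct [c0, c1, c2, c3, c4] \<and>
    E \<ominus> {u, v} = {{c0, c1}, {c1, c2}, {c2, c3}, {c3, c4}, {c4, c0}}" for c0 c1 c2 c3 c4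
  have rot: "cyc c1 c2 c3 c4 c0" if "cyc c0 c1 c2 c3 c4" for c0 c1 c2 c3 c4
    using that unfolding cyc_def by auto
  have mem: "e \<in> E \<and> e \<inter> {u, v} = {} \<longleftrightarrow> e \<in> {{c0, c1}, {c1, c2}, {c2, c3}, {c3, c4}, {c4, c0}}"
    if "cyc c0 c1 c2 c3 c4" for c0 c1 c2 c3 c4 e
    using in_delete_verts[of e E "{u, v}"] that unfolding cyc_def by simp
  have dis: "{u, v} \<inter> {c0, c1, c2, c3, c4} = {}" if "cyc c0 c1 c2 c3 c4" for c0 c1 c2 c3 c4
    using mem[OF that, of "{c0, c1}"] mem[OF that, of "{c2, c3}"] mem[OF that, of "{c3, c4}"] by auto
  have inE: "{c0, c1} \<in> E" if "cyc c0 c1 c2 c3 c4" for c0 c1 c2 c3 c4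
    using mem[OF that, of "{c0, c1}"] by auto
  have third: "\<exists>p q s. {p, q} = {u, v} \<and> distinct [p, q, s] \<and> s \<notin> {c1, c2, c3, c4} \<and> {p, s} \<in> E \<and>
      (\<forall>g. g \<in> E \<longrightarrow> g \<inter> {c1, c2, c3, c4} = {} \<longrightarrow> g = {u, v} \<or> g = {p, s})"
    if c: "cyc c0 c1 c2 c3 c4" for c0 c1 c2 c3 c4
    by (rule third_edge[OF E inE[OF rot[OF c]] inE[OF rot[OF rot[OF rot[OF c]]]] uv])
      (use dis[OF c] c in \<open>auto simp: cyc_def\<close>)
  obtain c0 c1 c2 c3 c4 where "distinct [c0, c1, c2, c3, c4]"
    "E \<ominus> {u, v} = {{c0, c1}, {c1, c2}, {c2, c3}, {c3, c4}, {c4, c0}}"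
    using H unfolding is_C5_def by (elim exE conjE) (rule that)
  \<comment> \<open>A rotation of the cycle turns a statement about \<open>c0\<close> into the same statement about any other vertex.\<close>
  then have c: "cyc c0 c1 c2 c3 c4" by (simp add: cyc_def)
  let ?C = "{c0, c1, c2, c3, c4}"
  show ?thesis
  proof (cases "\<exists>g\<in>E. g \<noteq> {u, v} \<and> g \<inter> ?C = {}")
    case True
    then obtain g where g: "g \<in> E" "g \<noteq> {u, v}" "g \<inter> ?C = {}" by blast
    have only: "e = {u, v} \<or> e = g"
      if d: "cyc d0 d1 d2 d3 d4" "{d0, d1, d2, d3, d4} = ?C" "e \<in> E" "e \<inter> {d1, d2, d3, d4} = {}"
      for d0 d1 d2 d3 d4 e
    proof -
      obtain p s where
        1: "\<And>g. g \<in> E \<Longrightarrow> g \<inter> {d1, d2, d3, d4} = {} \<Longrightarrow> g = {u, v} \<or> g = {p, s}"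
        using third[OF d(1)] by blast
      have "g \<inter> {d1, d2, d3, d4} = {}" using g(3) d(2) by blast
      from 1[OF g(1) this] have "g = {p, s}" using g(2) by simp
      then show ?thesis using 1[OF d(3,4)] by simp
    qed
    have off: "e = {u, v} \<or> e = g" if e: "e \<in> E" "e \<inter> {u, v} \<noteq> {}" for e
    proof -
      obtain t where t: "t \<in> e" "t \<in> {u, v}" using e(2) by blast
      obtain w where w: "e = {t, w}" using locally_circle_edgeE[OF E e(1) t(1)] .
      have t': "t \<notin> ?C" using dis[OF c] t(2) by auto
      note r1 = rot[OF c] note r2 = rot[OF r1] note r3 = rot[OF r2] note r4 = rot[OF r3]
      have dd: "distinct [c0, c1, c2, c3, c4]" using c by (simp add: cyc_def)
      consider "w = c1" | "w = c2" | "w = c3" | "w = c4" | "w \<notin> {c1, c2, c3, c4}" by blast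
      then show ?thesis
      proof cases
        case 1 show ?thesis by (rule only[OF r1 _ e(1)]) (use 1 w t' dd in auto)
      next
        case 2 show ?thesis by (rule only[OF r2 _ e(1)]) (use 2 w t' dd in auto)
      next
        case 3 show ?thesis by (rule only[OF r3 _ e(1)]) (use 3 w t' dd in auto)
      next
        case 4 show ?thesis by (rule only[OF r4 _ e(1)]) (use 4 w t' dd in auto)
      next
        case 5 show ?thesis by (rule only[OF c _ e(1)]) (use 5 w t' dd in auto)
      qed
    qed
    have "g \<inter> {u, v} \<noteq> {}"
    proof
      assume "g \<inter> {u, v} = {}"
      then have "g \<in> {{c0, c1}, {c1, c2}, {c2, c3}, {c3, c4}, {c4, c0}}" using mem[OF c, of g] g(1) by blast
      then show False using g(3) by auto
    qed
    then obtain p where p: "p \<in> g" "p \<in> {u, v}" by blast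
    obtain s where s: "g = {p, s}" "s \<noteq> p" using locally_circle_edgeE[OF E g(1) p(1)] .
    have "p \<in> {u, v}" using p by blast
    from locally_circle_edgeE[OF E uv this] obtain q where q: "{u, v} = {p, q}" "q \<noteq> p" .
    have sq: "s \<noteq> q" using g(2) s(1) q(1) by auto
    show ?thesis
    proof (rule is_P3_plus_circleI[OF E, of q p s])
      show "distinct [q, p, s]" using s(2) q(2) sq by auto
      show "{q, p} \<in> E" using uv q(1) by (simp add: insert_commute)
      show "{p, s} \<in> E" using g(1) s(1) by simp
      fix e assume e: "e \<in> E" "e \<inter> {q, p, s} \<noteq> {}"
      have "e \<inter> {u, v} \<noteq> {}"
      proof
        assume a: "e \<inter> {u, v} = {}"
        then have "s \<in> e" using e(2) q(1) by auto
        moreover have "e \<in> {{c0, c1}, {c1, c2}, {c2, c3}, {c3, c4}, {c4, c0}}"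
          using mem[OF c, of e] e(1) a by blast
        moreover have "s \<notin> ?C" using g(3) s(1) by auto
        ultimately show False by auto
      qed
      from off[OF e(1) this] show "e = {q, p} \<or> e = {p, s}"
        using q(1) s(1) by (simp add: insert_commute)
    qed
  next
    case False
    then have meets: "g \<inter> ?C \<noteq> {}" if "g \<in> E" "g \<noteq> {u, v}" for g using that by metis
    have spoke: "\<exists>p q. {p, q} = {u, v} \<and> p \<noteq> q \<and> {p, d0} \<in> E \<and> {q, d0} \<notin> E"
      if d: "cyc d0 d1 d2 d3 d4" "{d0, d1, d2, d3, d4} = ?C" for d0 d1 d2 d3 d4
    proof -
      obtain p q s where *: "{p, q} = {u, v}" "distinct [p, q, s]" "s \<notin> {d1, d2, d3, d4}" "{p, s} \<in> E"
        "\<And>g. g \<in> E \<Longrightarrow> g \<inter> {d1, d2, d3, d4} = {} \<Longrightarrow> g = {u, v} \<or> g = {p, s}"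
        using third[OF d(1)] by blast
      have dd: "distinct [d0, d1, d2, d3, d4]" using d(1) by (simp add: cyc_def)
      have pq: "p \<notin> ?C" "q \<notin> ?C" using dis[OF c] *(1) by auto
      have "{p, s} \<noteq> {u, v}" using *(1)[symmetric] *(2) by (auto simp: doubleton_eq_iff)
      with *(4) have "{p, s} \<inter> ?C \<noteq> {}" by (rule meets)
      then have "s \<in> {d0, d1, d2, d3, d4}" using pq d(2) by auto
      then have s: "s = d0" using *(3) by auto
      have "{q, d0} \<notin> E"
      proof
        assume a: "{q, d0} \<in> E"
        have "{q, d0} = {u, v} \<or> {q, d0} = {p, s}"
          by (rule *(5)[OF a]) (use pq d(2) dd in auto)
        then show False using *(1)[symmetric] *(2) s by (auto simp: doubleton_eq_iff)
      qed
      then show ?thesis using * s by auto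
    qed
    \<comment> \<open>If \<open>d0\<close> and \<open>d2\<close> had different neighbours \<open>p\<close> and \<open>q\<close>, deleting \<open>p d0\<close> and \<open>q d2\<close> would leave only \<open>d3 d4\<close>.\<close>
    have next2: "{p, d2} \<in> E" if d: "cyc d0 d1 d2 d3 d4" "{d0, d1, d2, d3, d4} = ?C"
      "{p, d0} \<in> E" "{p, q} = {u, v}" "p \<noteq> q" for d0 d1 d2 d3 d4 p q
    proof (rule ccontr)
      assume np: "{p, d2} \<notin> E"
      have dd: "distinct [d0, d1, d2, d3, d4]" using d(1) by (simp add: cyc_def)
      have pq: "p \<notin> {d0, d1, d2, d3, d4}" "q \<notin> {d0, d1, d2, d3, d4}"
        using dis[OF c] d(4) unfolding d(2) by auto
      have "cyc d2 d3 d4 d0 d1" using rot[OF rot[OF d(1)]] .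
      then obtain p' q' where "{p', q'} = {u, v}" "{p', d2} \<in> E"
        using spoke[of d2 d3 d4 d0 d1] d(2) by (auto simp: insert_commute)
      then have q2: "{q, d2} \<in> E" using np d(4) by (auto simp: doubleton_eq_iff)
      show False
      proof (rule no_single_remainder[OF E d(3) q2])
        show "{p, d0} \<inter> {q, d2} = {}" using pq dd d(5) by auto
        fix g assume g: "g \<in> E" "g \<inter> {p, d0, q, d2} = {}"
        then have "g \<inter> {u, v} = {}" using d(4) by blast
        then have "g \<in> {{d0, d1}, {d1, d2}, {d2, d3}, {d3, d4}, {d4, d0}}"
          using mem[OF d(1), of g] g(1) by blast
        then show "g = {d3, d4}" using g(2) by auto
      qed
    qed
    note r1 = rot[OF c] note r2 = rot[OF r1] note r3 = rot[OF r2] note r4 = rot[OF r3]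
    obtain p q where pq: "{p, q} = {u, v}" "p \<noteq> q" and p0: "{p, c0} \<in> E"
      using spoke[OF c] by auto
    have p2: "{p, c2} \<in> E" by (rule next2[OF c _ p0 pq]) auto
    have p4: "{p, c4} \<in> E" by (rule next2[OF r2 _ p2 pq]) auto
    have p1: "{p, c1} \<in> E" by (rule next2[OF r4 _ p4 pq]) auto
    have p3: "{p, c3} \<in> E" by (rule next2[OF r1 _ p1 pq]) auto
    have nq: "{q, d0} \<notin> E" if "{p, d0} \<in> E" "cyc d0 d1 d2 d3 d4" "{d0, d1, d2, d3, d4} = ?C"
      for d0 d1 d2 d3 d4
      using spoke[OF that(2,3)] that(1) pq by (auto simp: doubleton_eq_iff)
    have q: "{q, c3} \<notin> E" "{q, c4} \<notin> E"
      by (rule nq[OF p3 r3], blast) (rule nq[OF p4 r4], blast)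
    have c12: "{c1, c2} \<in> E" using inE[OF r1] .
    have pqC: "p \<notin> ?C" "q \<notin> ?C" using dis[OF c] pq(1) by auto
    have dd: "distinct [c0, c1, c2, c3, c4]" using c by (simp add: cyc_def)
    \<comment> \<open>The vertex \<open>q\<close> has no neighbour among the remaining vertices, so deleting \<open>p c0\<close> and \<open>c1 c2\<close> leaves only \<open>c3 c4\<close>.\<close>
    have False
    proof (rule no_single_remainder[OF E p0 c12])
      show "{p, c0} \<inter> {c1, c2} = {}" using pqC dd by auto
      fix g assume g: "g \<in> E" "g \<inter> {p, c0, c1, c2} = {}"
      have "q \<notin> g"
      proof
        assume "q \<in> g"
        from locally_circle_edgeE[OF E g(1) this] obtain w where w: "g = {q, w}" "w \<noteq> q" .
        have "w \<notin> ?C" using q g w(1) by auto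
        then have "g \<inter> ?C = {}" using w(1) pqC by auto
        moreover have "g \<noteq> {u, v}" using g(2) pq(1) by auto
        ultimately show False using meets[OF g(1)] by metis
      qed
      then have "g \<inter> {u, v} = {}" using g(2) pq(1) by blast
      then have "g \<in> {{c0, c1}, {c1, c2}, {c2, c3}, {c3, c4}, {c4, c0}}"
        using mem[OF c, of g] g(1) by blast
      then show "g = {c3, c4}" using g(2) by auto
    qed
    then show ?thesis ..
  qed
qed

lemma in_complete_bip: 
   "{s, t} \<in> complete_bip X A \<longleftrightarrow> (s \<in> X \<and> t \<in> A) \<or> (s \<in> A \<and> t \<in> X)"
  by (auto simp: complete_bip_def doubleton_eq_iff)

lemma complete_bip_insert:
  "complete_bip (insert x X) A = (\<lambda>a. {x, a}) ` A \<union> complete_bip X A"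
  "complete_bip {} A = {}"
  by (auto simp: complete_bip_def)

lemma is_K32_complete_bip:
  assumes "is_K32 B"
  obtains X A where "card X = 3" "card A = 2" "X \<inter> A = {}" "B = complete_bip X A"
proof -
  obtain x y z a b where *: "distinct [x, y, z, a, b]"
    "B = {{x, a}, {y, a}, {z, a}, {x, b}, {y, b}, {z, b}}"
    using assms unfolding is_K32_def by (elim exE conjE) (rule that)
  show ?thesis
    by (rule that[of "{x, y, z}" "{a, b}"]) (use *(1) in \<open>auto simp: complete_bip_insert *(2)\<close>)
qed

text \<open>
  In a \<open>K\<^sub>3\<^sub>,\<^sub>2\<close> a vertex \<open>b\<close> with neighbours \<open>y\<close>, \<open>z\<close> that is disjoint from an edge \<open>uv\<close> must lie on
  the side with two vertices: otherwise \<open>y\<close>, \<open>z\<close> and an end of \<open>uv\<close> would all lie on that side.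
\<close>

lemma K32_containing:
  assumes F: "is_K32 F" and e: "{u, v} \<in> F" "{b, y} \<in> F" "{b, z} \<in> F"
    and d: "distinct [u, v, b, y, z]"
  obtains p q where "{p, q} = {u, v}" "F = complete_bip {y, z, q} {b, p}"
proof -
  obtain X A where XA: "card X = 3" "card A = 2" "X \<inter> A = {}" "F = complete_bip X A"
    using is_K32_complete_bip[OF F] .
  obtain p q where pq: "{p, q} = {u, v}" "p \<in> A" "q \<in> X"
    using e(1) unfolding XA(4) in_complete_bip by (metis insert_commute)
  have pq': "p \<in> {u, v}" "q \<in> {u, v}" "p \<noteq> q" using pq(1) d by (auto simp: doubleton_eq_iff)
  have fin: "finite X" "finite A" using XA(1,2) by (auto intro: card_ge_0_finite)
  have "b \<in> A"
  proof (rule ccontr)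
    assume "b \<notin> A"
    then have "{y, z, p} \<subseteq> A" using e(2,3) pq unfolding XA(4) in_complete_bip by auto
    then have "card {y, z, p} \<le> 2" using card_mono[OF fin(2)] XA(2) by metis
    then show False using d pq' by auto
  qed
  then have "b \<notin> X" using XA(3) by blast
  then have yz: "y \<in> X" "z \<in> X" using e(2,3) unfolding XA(4) in_complete_bip by auto
  have "{b, p} = A" by (rule card_subset_eq[OF fin(2)]) (use \<open>b \<in> A\<close> pq pq' d XA(2) in auto)
  moreover have "{y, z, q} = X" by (rule card_subset_eq[OF fin(1)]) (use yz pq pq' d XA(1) in auto)
  ultimately show ?thesis using that pq(1) XA(4) by blast
qed

text \<open>
  Let deleting \<open>uv\<close> leave the \<open>K\<^sub>3\<^sub>,\<^sub>2\<close> with sides \<open>{x, y, z}\<close> and \<open>{a, b}\<close>. Deleting one of its edges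
  leaves a \<open>K\<^sub>3\<^sub>,\<^sub>2\<close> which contains \<open>uv\<close>, so one end \<open>p\<close> of \<open>uv\<close> joins the side of \<open>a\<close>, \<open>b\<close> and the other
  end \<open>q\<close> joins the side of \<open>x\<close>, \<open>y\<close>, \<open>z\<close>. The choice of \<open>p\<close> is the same for all these edges, and so the
  graph is complete bipartite with sides \<open>{x, y, z, q}\<close> and \<open>{a, b, p}\<close>.
\<close>

lemma K43_if_all_K32:
  assumes E: "locally_circle E" and K: "\<And>e. e \<in> E \<Longrightarrow> is_K32 (E \<ominus> e)"
  obtains X A where "card X = 4" "card A = 3" "X \<inter> A = {}" "E = complete_bip X A"
proof -
  have "E \<noteq> {}" using E by (simp add: locally_circle_def)
  then obtain u v where uv: "{u, v} \<in> E" "u \<noteq> v"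
    using E unfolding locally_circle_def by (metis card_2_iff ex_in_conv)
  obtain x y z a b where d: "distinct [x, y, z, a, b]"
    and H: "E \<ominus> {u, v} = {{x, a}, {y, a}, {z, a}, {x, b}, {y, b}, {z, b}}"
    using K[OF uv(1)] unfolding is_K32_def by (elim exE conjE) (rule that)
  have mem: "e \<in> E \<and> e \<inter> {u, v} = {} \<longleftrightarrow> e \<in> {{x, a}, {y, a}, {z, a}, {x, b}, {y, b}, {z, b}}" for e
    using in_delete_verts[of e E "{u, v}"] H by simp
  have dis: "{u, v} \<inter> {x, y, z, a, b} = {}"
    using mem[of "{x, a}"] mem[of "{y, b}"] mem[of "{z, a}"] by auto
  have rem: "\<exists>p q. {p, q} = {u, v} \<and> E \<ominus> {i, k} = complete_bip {j, l, q} {k', p}"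
    if "{i, j, l} = {x, y, z}" "{k, k'} = {a, b}" "distinct [i, j, l]" "distinct [k, k']" for i j l k k'
  proof -
    note dj = that(3)
    have sub: "i \<in> {x, y, z}" "j \<in> {x, y, z}" "l \<in> {x, y, z}" "k \<in> {a, b}" "k' \<in> {a, b}"
      using that(1,2) by auto
    have "{s, t} \<in> E" if "s \<in> {x, y, z}" "t \<in> {a, b}" for s t
      using mem[of "{s, t}"] that by auto
    note this[OF sub(1,4)] this[OF sub(2,5)] this[OF sub(3,5)]
    note inE = this
    have xa: "s \<noteq> t" if "s \<in> {x, y, z}" "t \<in> {a, b}" for s t using that d by auto
    then have ne: "i \<noteq> k'" "j \<noteq> k" "l \<noteq> k" "j \<noteq> k'" "l \<noteq> k'"
      using sub by - (rule xa; assumption)+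
    have "u \<noteq> s \<and> v \<noteq> s" if "s \<in> {x, y, z} \<or> s \<in> {a, b}" for s using dis that by auto
    note this[of i] this[of j] this[of l] this[of k] this[of k']
    then have ne2: "u \<notin> {i, j, l, k, k'}" "v \<notin> {i, j, l, k, k'}" using sub by blast+
    have "{u, v} \<in> E \<ominus> {i, k}" "{k', j} \<in> E \<ominus> {i, k}" "{k', l} \<in> E \<ominus> {i, k}"
      unfolding in_delete_verts insert_commute[of k' j] insert_commute[of k' l]
      using uv inE ne ne2 that(3,4) by auto
    from K32_containing[OF K[OF inE(1)] this] obtain p q
      where "{p, q} = {u, v}" "E \<ominus> {i, k} = complete_bip {j, l, q} {k', p}"
      using uv ne ne2 dj by auto
    then show ?thesis by blast
  qed
  obtain p q where pq: "{p, q} = {u, v}" and xa: "E \<ominus> {x, a} = complete_bip {y, z, q} {b, p}"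
    using rem[of x y z a b] d by auto
  have pq': "p \<noteq> q" "p \<notin> {x, y, z, a, b}" "q \<notin> {x, y, z, a, b}"
    using pq uv(2) dis by (auto simp: doubleton_eq_iff)
  \<comment> \<open>The vertex \<open>q\<close> is not joined to \<open>z\<close>, which fixes the roles of the ends of \<open>uv\<close> in every other deletion that keeps \<open>z\<close>.\<close>
  have other: "p' = p \<and> q' = q" if "{p', q'} = {u, v}" "{p', z} \<in> E" for p' q'
  proof (rule ccontr)
    assume "\<not> (p' = p \<and> q' = q)"
    then have "p' = q" using that(1) pq by (auto simp: doubleton_eq_iff)
    then have "{q, z} \<in> E \<ominus> {x, a}" using that(2) pq' d by (auto simp: in_delete_verts)
    then show False using d pq' unfolding xa in_complete_bip by auto
  qed
  have ya: "E \<ominus> {y, a} = complete_bip {x, z, q} {b, p}"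
  proof -
    obtain p' q' where *: "{p', q'} = {u, v}" "E \<ominus> {y, a} = complete_bip {x, z, q'} {b, p'}"
      using rem[of y x z a b] d by (auto simp: insert_commute)
    have "{p', z} \<in> E \<ominus> {y, a}" unfolding *(2) in_complete_bip by auto
    then have "{p', z} \<in> E" by (simp add: in_delete_verts)
    then have "p' = p" "q' = q" using other[OF *(1)] by auto
    then show ?thesis using *(2) by simp
  qed
  have xb: "E \<ominus> {x, b} = complete_bip {y, z, q} {a, p}"
  proof -
    obtain p' q' where *: "{p', q'} = {u, v}" "E \<ominus> {x, b} = complete_bip {y, z, q'} {a, p'}"
      using rem[of x y z b a] d by (auto simp: insert_commute)
    have "{p', z} \<in> E \<ominus> {x, b}" unfolding *(2) in_complete_bip by auto
    then have "{p', z} \<in> E" by (simp add: in_delete_verts)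
    then have "p' = p" "q' = q" using other[OF *(1)] by auto
    then show ?thesis using *(2) by simp
  qed
  have cover: "e \<in> E \<ominus> {u, v} \<or> e \<in> E \<ominus> {x, a} \<or> e \<in> E \<ominus> {y, a} \<or> e \<in> E \<ominus> {x, b}"
    if e: "e \<in> E" for e
  proof (cases "e \<inter> {u, v} = {}")
    case False
    then obtain t where t: "t \<in> e" "t \<in> {u, v}" by blast
    obtain w where w: "e = {t, w}" using locally_circle_edgeE[OF E e t(1)] .
    then show ?thesis using e t(2) dis d by (auto simp: in_delete_verts)
  qed (use e in \<open>auto simp: in_delete_verts\<close>)
  have H': "E \<ominus> {u, v} = complete_bip {x, y, z} {a, b}"
    unfolding H by (auto simp: complete_bip_insert)
  have "E = E \<ominus> {u, v} \<union> E \<ominus> {x, a} \<union> E \<ominus> {y, a} \<union> E \<ominus> {x, b}"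
  proof (rule subset_antisym)
    show "E \<subseteq> E \<ominus> {u, v} \<union> E \<ominus> {x, a} \<union> E \<ominus> {y, a} \<union> E \<ominus> {x, b}" using cover by auto
  qed (auto simp: in_delete_verts)
  also have "\<dots> = complete_bip {x, y, z, q} {a, b, p}"
    unfolding H' xa ya xb complete_bip_insert by auto
  finally show ?thesis using that[of "{x, y, z, q}" "{a, b, p}"] d pq' by auto
qed

lemma locally_circle_cases:
  assumes "locally_circle E"
  obtains "is_P3_plus_circle E"
  | X A where "card X = 4" "card A = 3" "X \<inter> A = {}" "E = complete_bip X A"
proof (cases "\<forall>e\<in>E. is_K32 (E \<ominus> e)")
  case True
  then show ?thesis using K43_if_all_K32[OF assms] that(2) by blast
next
  case False
  then obtain e where e: "e \<in> E" "\<not> is_K32 (E \<ominus> e)" by blast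
  then have "is_2P3 (E \<ominus> e) \<or> is_C5 (E \<ominus> e)"
    using locally_P3_classification[of "E \<ominus> e"] assms unfolding locally_circle_def by blast
  moreover obtain u v where "e = {u, v}"
    using assms e(1) unfolding locally_circle_def by (meson card_2_iff)
  ultimately show ?thesis
    using that(1) P3_plus_circle_if_2P3[OF assms] P3_plus_circle_if_C5[OF assms] e(1) by blast
qed

section \<open>From homology spheres to graphs\<close>

lemma in_matching_complex:
  "F \<in> matching_complex G \<longleftrightarrow> F \<subseteq> edges G \<and> (\<forall>e\<in>F. \<forall>f\<in>F. e \<noteq> f \<longrightarrow> e \<inter> f = {})"
  by (simp add: matching_complex_def disjoint_def)

text \<open>
  The dimension bounds matchings by three edges, and the homology of the link of a face with fewer
  than three edges makes it extendable. The link of two disjoint edges is \<open>0\<close>-dimensional, so it has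
  exactly two points; two disjoint ones would give a matching with four edges.
\<close>

lemma locally_circle_if_homology_sphere:
  fixes G :: "'a graph"
  assumes G: "finite_simple_graph G"
    and S: "homology_sphere TYPE('k::field) 2 (matching_complex G)"
  shows "locally_circle (edges G)"
proof -
  define M where "M = matching_complex G"
  note M = in_matching_complex[of _ G, folded M_def]
  have c2: "card e = 2" if "e \<in> edges G" for e using G that by (auto simp: finite_simple_graph_def)
  have "finite (verts G)" "edges G \<subseteq> Pow (verts G)"
    using G by (auto simp: finite_simple_graph_def)
  then have finE: "finite (edges G)" by (meson finite_Pow_iff finite_subset)
  have finM: "finite M" and dim: "complex_dim M = 2"
    using S by (auto simp: homology_sphere_def M_def finite_simplicial_complex_def)
  have small: "card F \<le> 3" if "F \<in> M" for F
  proof -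
    have "int (card F) - 1 \<le> complex_dim M"
      unfolding complex_dim_def by (rule Max_ge) (use finM that in auto)
    then show ?thesis using dim by simp
  qed
  have one: "homology_one_dimensional TYPE('k) (link M F) (2 - int (card F))" if "F \<in> M" for F
    using S that by (auto simp: homology_sphere_def M_def has_homology_of_sphere_def)
  have extend: "\<exists>g. g \<in> edges G \<and> (\<forall>e\<in>F. g \<inter> e = {})" if F: "F \<in> M" "card F \<le> 2" for F
  proof -
    obtain T where T: "T \<in> link M F" "int (card T) = 2 - int (card F) + 1"
      using face_of_homology_one_dimensional[OF one[OF F(1)]] by blast
    then have "T \<noteq> {}" using F(2) by auto
    then obtain g where g: "g \<in> T" by blast
    have TF: "T \<union> F \<in> M" "T \<inter> F = {}" using T(1) by (auto simp: link_def)
    have "g \<inter> e = {}" if "e \<in> F" for e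
    proof -
      have "g \<noteq> e" using g that TF(2) by auto
      then show ?thesis using TF(1) g that unfolding M by auto
    qed
    moreover have "g \<in> edges G" using TF(1) g unfolding M by auto
    ultimately show ?thesis by blast
  qed
  have P3: "is_P3 (edges G \<ominus> e \<ominus> f)" if e: "e \<in> edges G" and f: "f \<in> edges G \<ominus> e" for e f
  proof -
    have f': "f \<in> edges G" "f \<inter> e = {}" using f by (auto simp: delete_verts_def)
    have ne: "e \<noteq> f" using c2[OF e] f'(2) by auto
    have F: "{e, f} \<in> M" using e f' unfolding M by auto
    have L: "homology_one_dimensional TYPE('k) (link M {e, f}) 0" using one[OF F] ne by simp
    define D where "D = edges G \<ominus> e \<ominus> f"
    have D: "g \<in> D \<longleftrightarrow> g \<in> edges G \<and> g \<inter> e = {} \<and> g \<inter> f = {}" for g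
      by (auto simp: D_def delete_verts_def)
    have faces: "T \<union> {e, f} \<in> M" "e \<notin> T" "f \<notin> T" if "T \<in> link M {e, f}" for T
      using that by (auto simp: link_def)
    have sub: "T \<subseteq> D" if T: "T \<in> link M {e, f}" for T
    proof
      fix g assume "g \<in> T"
      then have "g \<in> edges G" "g \<noteq> e" "g \<noteq> f" using faces[OF T] unfolding M by auto
      then show "g \<in> D" using faces(1)[OF T] \<open>g \<in> T\<close> unfolding D M by auto
    qed
    have single: "{g} \<in> link M {e, f}" if g: "g \<in> D" for g
    proof -
      have "g \<noteq> e" "g \<noteq> f" using c2[of g] g unfolding D by auto
      moreover have "e \<inter> f = {}" using f' by auto
      ultimately show ?thesis using g e f' unfolding link_def M D by (auto simp: Int_commute)
    qed
    have "\<Union>(link M {e, f}) = D" using sub single by blast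
    moreover have "finite D" using finE by (simp add: D_def delete_verts_def)
    moreover have "finite T \<and> card T \<le> 1" if T: "T \<in> link M {e, f}" for T
    proof -
      have "finite T" using sub[OF T] \<open>finite D\<close> by (rule finite_subset)
      moreover have "card (T \<union> {e, f}) = card T + card {e, f}"
        by (rule card_Un_disjoint) (use \<open>finite T\<close> faces[OF T] in auto)
      ultimately show ?thesis using small[OF faces(1)[OF T]] ne by simp
    qed
    ultimately have "card D = 2" using two_points_of_homology[OF _ _ L] by metis
    then obtain g h where gh: "D = {g, h}" "g \<noteq> h" by (meson card_2_iff)
    have g: "g \<in> edges G" "g \<inter> e = {}" "g \<inter> f = {}" and h: "h \<in> edges G" "h \<inter> e = {}" "h \<inter> f = {}"
      using D[of g] D[of h] gh(1) by auto
    have ne': "g \<noteq> e" "g \<noteq> f" "h \<noteq> e" "h \<noteq> f" using c2[OF g(1)] c2[OF h(1)] g h by auto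
    have "g \<inter> h \<noteq> {}"
    proof
      assume "g \<inter> h = {}"
      then have "{e, f, g, h} \<in> M" using e f' g h unfolding M by (auto simp: Int_commute)
      from small[OF this] show False using ne ne' gh(2) by simp
    qed
    then obtain y where y: "y \<in> g" "y \<in> h" by blast
    obtain x where x: "g = {x, y}" "x \<noteq> y"
      using c2[OF g(1)] y(1) unfolding card_2_iff by (metis insert_commute insert_iff singletonD)
    obtain z where z: "h = {y, z}" "y \<noteq> z"
      using c2[OF h(1)] y(2) unfolding card_2_iff by (metis insert_commute insert_iff singletonD)
    have "distinct [x, y, z]" using x z gh(2) by auto
    then show ?thesis unfolding is_P3_def using gh(1) x(1) z(1) D_def by metis
  qed
  have "{} \<in> M" unfolding M by simp
  then have "edges G \<noteq> {}" using extend[of "{}"] by auto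
  moreover have "locally_P3 (edges G \<ominus> e)" if e: "e \<in> edges G" for e
  proof -
    have "{e} \<in> M" using e unfolding M by simp
    then obtain f where "f \<in> edges G" "f \<inter> e = {}" using extend[of "{e}"] by auto
    then have "edges G \<ominus> e \<noteq> {}" by (auto simp: delete_verts_def)
    moreover have "card f = 2" if "f \<in> edges G \<ominus> e" for f using c2 that by (auto simp: delete_verts_def)
    ultimately show ?thesis using P3[OF e] by (auto simp: locally_P3_def)
  qed
  ultimately show ?thesis using c2 unfolding locally_circle_def by blast
qed

text \<open>
  Either \<open>a\<close> follows \<open>b\<close> and \<open>b\<close> follows \<open>c\<close> in the cyclic order, or both steps go backwards.
\<close>

lemma mod_3_cyclic:
  fixes a b c :: nat
  assumes "a < 3" "b < 3" "c < 3" "a \<noteq> b" "b \<noteq> c" "a \<noteq> c"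
  shows "(b + 1) mod 3 = a \<longleftrightarrow> b = (c + 1) mod 3"
proof -
  have "n = 0 \<or> n = 1 \<or> n = 2" if "n < 3" for n :: nat using that by auto
  from this[OF assms(1)] this[OF assms(2)] this[OF assms(3)] show ?thesis
    using assms(4-6) by (elim disjE) simp_all
qed

text \<open>
  The edges of \<open>K\<^sub>4\<^sub>,\<^sub>3\<close> are the squares \<open>(i, a)\<close> of a board with four columns and three rows, and
  matchings are placements of rooks that do not attack each other. In the link of a square the
  neighbours form a hexagon, and following opposite vertices of these hexagons from a square in
  column \<open>0\<close> gives a closed line through the six squares in columns \<open>0\<close> and \<open>1\<close>; the remaining six
  squares form a parallel line. These lines are the two curves of the cut. They bound two annuli, which
  are told apart by the cyclic order of the two rows modulo 3 and the parity of the sum of the two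
  columns.
\<close>

lemma homology_nontrivial_matching_complex_K43:
  fixes G :: "'a graph"
  assumes XA: "card X = 4" "card A = 3" "X \<inter> A = {}" and E: "edges G = complete_bip X A"
  shows "\<not> homology_trivial TYPE('k::field) (matching_complex G) 1"
proof -
  have fin: "finite X" "finite A" using XA(1,2) by (auto intro: card_ge_0_finite)
  obtain x where x: "bij_betw x {0..<4::nat} X" using ex_bij_betw_nat_finite[OF fin(1)] XA(1) by auto
  obtain y where y: "bij_betw y {0..<3::nat} A" using ex_bij_betw_nat_finite[OF fin(2)] XA(2) by auto
  define r where "r i a = {x i, y a}" for i a
  have xX: "x i \<in> X" if "i < 4" for i using x that by (auto simp: bij_betw_def)
  have yA: "y a \<in> A" if "a < 3" for a using y that by (auto simp: bij_betw_def)
  have xeq: "x i = x j \<longleftrightarrow> i = j" if "i < 4" "j < 4" for i j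
    using x that by (auto simp: bij_betw_def inj_on_def)
  have yeq: "y a = y b \<longleftrightarrow> a = b" if "a < 3" "b < 3" for a b
    using y that by (auto simp: bij_betw_def inj_on_def)
  have xy: "x i \<noteq> y a" "y a \<noteq> x i" if "i < 4" "a < 3" for i a
    using xX[OF that(1)] yA[OF that(2)] XA(3) by auto
  have E': "edges G = {r i a | i a. i < 4 \<and> a < 3}"
  proof -
    have XA': "X = x ` {0..<4}" "A = y ` {0..<3}" using x y by (simp_all add: bij_betw_def)
    have "e \<in> edges G \<longleftrightarrow> (\<exists>s\<in>X. \<exists>t\<in>A. e = {s, t})" for e
      unfolding E complete_bip_def by blast
    also have "\<dots> e \<longleftrightarrow> (\<exists>i\<in>{0..<4}. \<exists>a\<in>{0..<3}. e = r i a)" for e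
      unfolding XA' r_def by (simp only: bex_simps)
    finally have "e \<in> edges G \<longleftrightarrow> (\<exists>i\<in>{0..<4}. \<exists>a\<in>{0..<3}. e = r i a)" for e .
    then have "e \<in> edges G \<longleftrightarrow> (\<exists>i a. e = r i a \<and> i < 4 \<and> a < 3)" for e
      unfolding Bex_def atLeastLessThan_iff by (metis le0)
    then show ?thesis by blast
  qed
  have disj: "r i a \<inter> r j b = {} \<longleftrightarrow> i \<noteq> j \<and> a \<noteq> b" if "i < 4" "a < 3" "j < 4" "b < 3" for i a j b
    using that xeq yeq xy unfolding r_def by auto
  have req: "r i a = r j b \<longleftrightarrow> i = j \<and> a = b" if "i < 4" "a < 3" "j < 4" "b < 3" for i a j b
    using that xeq yeq xy unfolding r_def by (auto simp: doubleton_eq_iff)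
  define M where "M = matching_complex G"
  define L where "L = {r i a | i a. i < 2 \<and> a < 3}"
  define R where "R = {r i a | i a. 2 \<le> i \<and> i < 4 \<and> a < 3}"
  define up where "up e f \<longleftrightarrow> (\<exists>i j a b. i < 2 \<and> 2 \<le> j \<and> j < 4 \<and> a < 3 \<and> b < 3 \<and> e = r i a \<and> f = r j b \<and>
      (if even (i + j) then (b + 1) mod 3 = a else b = (a + 1) mod 3))" for e f
  have up: "up (r i a) (r j b) \<longleftrightarrow> (if even (i + j) then (b + 1) mod 3 = a else b = (a + 1) mod 3)"
    if "i < 2" "2 \<le> j" "j < 4" "a < 3" "b < 3" for i j a b
    unfolding up_def using that req by (smt (verit) less_le_trans one_less_numeral_iff semiring_norm(76) numeral_le_iff order.strict_trans)
  have M: "F \<in> M \<longleftrightarrow> F \<subseteq> edges G \<and> (\<forall>e\<in>F. \<forall>f\<in>F. e \<noteq> f \<longrightarrow> e \<inter> f = {})" for F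
    unfolding M_def by (rule in_matching_complex)
  have pair: "{r i a, r j b} \<in> M" if "i < 4" "a < 3" "j < 4" "b < 3" "i \<noteq> j" "a \<noteq> b" for i j a b
    unfolding M E' using that disj[of i a j b] by (auto simp: Int_commute)
  have apart: "i \<noteq> j \<and> a \<noteq> b" if "F \<in> M" "r i a \<in> F" "r j b \<in> F" "r i a \<noteq> r j b"
     "i < 4" "a < 3" "j < 4" "b < 3" for F i a j b
    using that disj[of i a j b] unfolding M by auto
  have "\<not> homology_trivial TYPE('k) M 1"
  proof (rule homology_nontrivial_if_cut[where L = L and R = R and up = up
        and ?e0.0 = "r 0 0" and ?e1.0 = "r 2 2" and ?e2.0 = "r 0 1" and ?e3.0 = "r 1 2"])
    have "L = (\<lambda>(i, a). r i a) ` ({..<2} \<times> {..<3})" "R = (\<lambda>(i, a). r i a) ` ({2..<4} \<times> {..<3})"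
      unfolding L_def R_def by (auto; blast)+
    then show "finite L" "finite R" by auto
    have EM: "\<Union>M = edges G"
    proof
      show "edges G \<subseteq> \<Union>M"
      proof
        fix e assume "e \<in> edges G"
        then have "{e} \<in> M" unfolding M by simp
        then show "e \<in> \<Union>M" by blast
      qed
    qed (auto simp: M)
    show "\<Union>M = L \<union> R" unfolding EM E' L_def R_def by (auto; force)
    show "L \<inter> R = {}" unfolding L_def R_def using req by fastforce
    show "up e f \<longleftrightarrow> up e' f" if h: "e \<in> L" "e' \<in> L" "f \<in> R" "distinct [e, e', f]" "{e, e', f} \<in> M" for e e' f
    proof -
      obtain i a where e: "e = r i a" "i < 2" "a < 3" using h(1) by (auto simp: L_def)
      obtain i' a' where e': "e' = r i' a'" "i' < 2" "a' < 3" using h(2) by (auto simp: L_def)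
      obtain j b where f: "f = r j b" "2 \<le> j" "j < 4" "b < 3" using h(3) by (auto simp: R_def)
      have 1: "i \<noteq> i'" "a \<noteq> a'" using apart[OF h(5), of i a i' a'] h(4) e e' by auto
      have 2: "b \<noteq> a" "b \<noteq> a'" using apart[OF h(5), of i a j b] apart[OF h(5), of i' a' j b] h(4) e e' f by auto
      have "even (i + j) \<longleftrightarrow> \<not> even (i' + j)" using 1(1) e(2) e'(2) by presburger
      moreover have "(b + 1) mod 3 = a \<longleftrightarrow> b = (a' + 1) mod 3" "b = (a + 1) mod 3 \<longleftrightarrow> (b + 1) mod 3 = a'"
        using mod_3_cyclic[OF e(3) f(4) e'(3)] mod_3_cyclic[OF e'(3) f(4) e(3)] 1(2) 2 by auto
      ultimately show ?thesis
        unfolding e(1) e'(1) f(1) up[OF e(2) f(2,3) e(3) f(4)] up[OF e'(2) f(2,3) e'(3) f(4)] by simp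
    qed
    show "up e f \<longleftrightarrow> up e f'" if h: "e \<in> L" "f \<in> R" "f' \<in> R" "distinct [e, f, f']" "{e, f, f'} \<in> M" for e f f'
    proof -
      obtain i a where e: "e = r i a" "i < 2" "a < 3" using h(1) by (auto simp: L_def)
      obtain j b where f: "f = r j b" "2 \<le> j" "j < 4" "b < 3" using h(2) by (auto simp: R_def)
      obtain j' b' where f': "f' = r j' b'" "2 \<le> j'" "j' < 4" "b' < 3" using h(3) by (auto simp: R_def)
      have 1: "j \<noteq> j'" "b \<noteq> b'" using apart[OF h(5), of j b j' b'] h(4) f f' by auto
      have 2: "b \<noteq> a" "b' \<noteq> a" using apart[OF h(5), of i a j b] apart[OF h(5), of i a j' b'] h(4) e f f' by auto
      have "even (i + j) \<longleftrightarrow> \<not> even (i + j')" using 1(1) f(2,3) f'(2,3) by presburger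
      moreover have "(b + 1) mod 3 = a \<longleftrightarrow> b' = (a + 1) mod 3" "b = (a + 1) mod 3 \<longleftrightarrow> (b' + 1) mod 3 = a"
        using mod_3_cyclic[OF e(3) f(4) f'(4)] mod_3_cyclic[OF e(3) f'(4) f(4)]
          mod_3_cyclic[OF f(4) f'(4) e(3)] mod_3_cyclic[OF f'(4) f(4) e(3)] 1(2) 2 by auto
      ultimately show ?thesis
        unfolding e(1) f(1) f'(1) up[OF e(2) f(2,3) e(3) f(4)] up[OF e(2) f'(2,3) e(3) f'(4)] by simp
    qed
    \<comment> \<open>The loop crosses from column \<open>0\<close> to column \<open>2\<close> in one annulus and returns through the other.\<close>
    show "r 0 0 \<in> L" "r 0 1 \<in> L" "r 1 2 \<in> L" unfolding L_def by force+
    show "r 2 2 \<in> R" unfolding R_def by force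
    show "r 0 1 \<noteq> r 1 2" "r 1 2 \<noteq> r 0 0" by (simp_all add: req)
    show "{r 0 0, r 2 2} \<in> M" "{r 2 2, r 0 1} \<in> M" "{r 0 1, r 1 2} \<in> M" "{r 1 2, r 0 0} \<in> M"
      by (simp_all add: pair)
    show "up (r 0 0) (r 2 2)" "\<not> up (r 0 1) (r 2 2)" by (simp_all add: up)
  qed
  then show ?thesis by (simp add: M_def)
qed

section \<open>Recognising graphs and bipyramids\<close>

text \<open>
  A finite graph given by a list of vertices and a list of index pairs is determined up to isomorphism
  by the index pairs.
\<close>

lemma graph_iso_lists:
  assumes d: "distinct vs" "distinct ws" "length vs = length ws"
    and V: "verts G = set vs" "verts H = set ws"
    and E: "edges G = (\<lambda>(i, j). {vs ! i, vs ! j}) ` set ps"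
      "edges H = (\<lambda>(i, j). {ws ! i, ws ! j}) ` set ps"
    and ps: "\<forall>(i, j) \<in> set ps. i < length vs \<and> j < length vs"
  shows "graph_iso G H"
proof -
  have bv: "bij_betw ((!) vs) {..<length vs} (set vs)" and bw: "bij_betw ((!) ws) {..<length vs} (set ws)"
    using d by (auto intro: bij_betw_nth)
  define f where "f = (!) ws \<circ> inv_into {..<length vs} ((!) vs)"
  have "bij_betw f (verts G) (verts H)"
    unfolding f_def V by (rule bij_betw_trans[OF bij_betw_inv_into[OF bv] bw])
  moreover have f: "f (vs ! i) = ws ! i" if "i < length vs" for i
    using bij_betw_inv_into_left[OF bv] that by (simp add: f_def)
  have "f ` {vs ! i, vs ! j} = {ws ! i, ws ! j}" if "(i, j) \<in> set ps" for i j
    using ps that f by fastforce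
  then have "edges H = (\<lambda>e. f ` e) ` edges G"
    unfolding E image_image by (intro image_cong refl) (auto split: prod.splits)
  ultimately show ?thesis unfolding graph_iso_def by blast
qed

lemma complex_iso_sym:
  assumes "complex_iso K L" shows "complex_iso L K"
proof -
  obtain f where f: "bij_betw f (\<Union>K) (\<Union>L)" "L = (\<lambda>\<sigma>. f ` \<sigma>) ` K"
    using assms unfolding complex_iso_def by blast
  let ?g = "inv_into (\<Union>K) f"
  have "?g ` f ` \<sigma> = \<sigma>" if "\<sigma> \<in> K" for \<sigma>
    using f(1) that by (intro inv_into_image_cancel) (auto simp: bij_betw_def)
  then have "K = (\<lambda>\<sigma>. ?g ` \<sigma>) ` L" unfolding f(2) image_image by simp
  then show ?thesis using bij_betw_inv_into[OF f(1)] unfolding complex_iso_def by blast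
qed

definition cyclically_adjacent :: "nat \<Rightarrow> nat \<Rightarrow> nat \<Rightarrow> bool"
  where "cyclically_adjacent n i j \<longleftrightarrow> j = (i + 1) mod n \<or> i = (j + 1) mod n"

text \<open>
  A cycle of length at least 4 has no triangle, so it contains every set of pairwise adjacent
  vertices as a face. For \<open>n = 3\<close> the set of all three vertices would be an exception.
\<close>

lemma cyclically_adjacent_clique:
  assumes n: "n \<ge> 4" and S: "S \<subseteq> {..<n}"
    and adj: "\<And>i j. i \<in> S \<Longrightarrow> j \<in> S \<Longrightarrow> i \<noteq> j \<Longrightarrow> cyclically_adjacent n i j"
  shows "S \<in> graph_complex (cycle_graph n)"
proof (cases "\<exists>i j. i \<in> S \<and> j \<in> S \<and> i \<noteq> j")
  case False
  then have "S = {} \<or> (\<exists>i. S = {i})" by blast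
  then show ?thesis using S by (auto simp: graph_complex_def cycle_graph_def)
next
  case True
  then obtain i j where "i \<in> S" "j \<in> S" "j = (i + 1) mod n"
    using adj unfolding cyclically_adjacent_def by blast
  note ij = this
  have modn: "Suc k mod n = (if Suc k = n then 0 else Suc k)" if "k < n" for k
    using that by auto
  have "k = i \<or> k = j" if k: "k \<in> S" for k
  proof (rule ccontr)
    assume "\<not> ?thesis"
    then have "cyclically_adjacent n k i" "cyclically_adjacent n k j" using adj k ij by auto
    moreover have "i < n" "j < n" "k < n" using S ij k by auto
    ultimately show False using ij(3) n unfolding cyclically_adjacent_def
      by (auto simp: modn split: if_splits)
  qed
  then have "S = {i, (i + 1) mod n}" using ij by blast
  moreover have "i < n" using S ij by auto
  ultimately show ?thesis by (auto simp: graph_complex_def cycle_graph_def)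
qed

text \<open>
  Both complexes are determined by which pairs of vertices form a face: a matching is a set of
  pairwise disjoint edges, and the faces of the bipyramid are the sets of pairwise adjacent vertices.
  So it suffices that the edges \<open>cs\<close> are disjoint exactly when neighbouring in the cyclic order of the
  list, and that \<open>p\<close> and \<open>q\<close> meet each other but no edge in \<open>cs\<close>.
\<close>

lemma matching_complex_bipyramid:
  assumes n: "length cs = n" "n \<ge> 4" and d: "distinct (p # q # cs)"
    and E: "edges G = {p, q} \<union> set cs"
    and pq: "p \<inter> q \<noteq> {}" and off: "\<And>c. c \<in> set cs \<Longrightarrow> p \<inter> c = {} \<and> q \<inter> c = {}"
    and cyc: "\<And>i j. i < n \<Longrightarrow> j < n \<Longrightarrow> i \<noteq> j \<Longrightarrow> cs ! i \<inter> cs ! j = {} \<longleftrightarrow> cyclically_adjacent n i j"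
  shows "complex_iso (matching_complex G) (bipyramid_boundary n)"
proof (rule complex_iso_sym)
  define g where "g = case_sum ((!) cs) (\<lambda>b. if b then q else p)"
  have gs[simp]: "g (Inl i) = cs ! i" "g (Inr b) = (if b then q else p)" for i b
    by (simp_all add: g_def)
  have B: "bipyramid_boundary n = {\<sigma> <+> \<tau> | \<sigma> \<tau>. \<sigma> \<in> graph_complex (cycle_graph n) \<and> \<tau> \<in> two_points}"
    by (simp add: bipyramid_boundary_def join_def)
  have img: "g ` (\<sigma> <+> \<tau>) = (!) cs ` \<sigma> \<union> (\<lambda>b. if b then q else p) ` \<tau>" for \<sigma> \<tau>
    by (auto simp: Plus_def image_Un image_image)
  have cyc_face: "\<sigma> \<subseteq> {..<n} \<and> (\<forall>i\<in>\<sigma>. \<forall>j\<in>\<sigma>. i \<noteq> j \<longrightarrow> cyclically_adjacent n i j)"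
    if "\<sigma> \<in> graph_complex (cycle_graph n)" for \<sigma>
    using that n(2) by (auto simp: graph_complex_def cycle_graph_def cyclically_adjacent_def)
  have UB: "\<Union>(bipyramid_boundary n) = {..<n} <+> UNIV"
  proof
    show "\<Union>(bipyramid_boundary n) \<subseteq> {..<n} <+> UNIV" unfolding B using cyc_face by blast
    have "{i} <+> {b} \<in> bipyramid_boundary n" if "i < n" for i b
      unfolding B using that by (auto simp: graph_complex_def cycle_graph_def two_points_def)
    moreover have "0 < n" using n(2) by simp
    ultimately have "{i} <+> {b} \<in> bipyramid_boundary n" if "i < n" for i b using that by blast
    then show "{..<n} <+> UNIV \<subseteq> \<Union>(bipyramid_boundary n)" using \<open>0 < n\<close> by blast
  qed
  have "\<Union>(matching_complex G) = edges G"
  proof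
    have "{e} \<in> matching_complex G" if "e \<in> edges G" for e using that by (simp add: in_matching_complex)
    then show "edges G \<subseteq> \<Union>(matching_complex G)" by blast
  qed (auto simp: in_matching_complex)
  moreover have "bij_betw g ({..<n} <+> UNIV) (edges G)"
    unfolding bij_betw_def
  proof
    have ne: "cs ! i \<noteq> p" "cs ! i \<noteq> q" if "i < n" for i using d that n(1) nth_mem by force+
    show "inj_on g ({..<n} <+> UNIV)"
    proof (rule inj_onI)
      fix s t assume st: "s \<in> {..<n} <+> UNIV" "t \<in> {..<n} <+> (UNIV :: bool set)" "g s = g t"
      show "s = t"
        using st ne d n(1) ne[THEN not_sym]
        by (cases s; cases t) (auto simp: nth_eq_iff_index_eq split: if_splits)
    qed
    have "(!) cs ` {..<n} = set cs" using n(1) by (auto simp: set_conv_nth)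
    then show "g ` ({..<n} <+> UNIV) = edges G" unfolding img E by (auto simp: UNIV_bool)
  qed
  moreover have "matching_complex G = (\<lambda>\<sigma>. g ` \<sigma>) ` bipyramid_boundary n"
  proof (intro subset_antisym subsetI)
    fix F assume F: "F \<in> matching_complex G"
    define \<sigma> where "\<sigma> = {i. i < n \<and> cs ! i \<in> F}"
    define \<tau> where "\<tau> = {b. (if b then q else p) \<in> F}"
    have "\<sigma> \<in> graph_complex (cycle_graph n)"
    proof (rule cyclically_adjacent_clique[OF n(2)])
      fix i j assume ij: "i \<in> \<sigma>" "j \<in> \<sigma>" "i \<noteq> j"
      then have "cs ! i \<noteq> cs ! j" using d n(1) by (simp add: \<sigma>_def nth_eq_iff_index_eq)
      then show "cyclically_adjacent n i j"
        using ij F cyc[of i j] by (simp add: \<sigma>_def in_matching_complex)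
    qed (auto simp: \<sigma>_def)
    moreover have "\<tau> \<in> two_points"
    proof -
      have "\<not> (p \<in> F \<and> q \<in> F)" using F d pq unfolding in_matching_complex by auto
      then have "False \<notin> \<tau> \<or> True \<notin> \<tau>" by (simp add: \<tau>_def)
      then show ?thesis unfolding two_points_def by (cases "False \<in> \<tau>"; cases "True \<in> \<tau>") (auto, (metis (full_types))+)
    qed
    ultimately have "\<sigma> <+> \<tau> \<in> bipyramid_boundary n" unfolding B by blast
    moreover have "F = g ` (\<sigma> <+> \<tau>)"
    proof -
      have "F \<subseteq> {p, q} \<union> set cs" using F by (simp add: in_matching_complex E)
      then show ?thesis unfolding img \<sigma>_def \<tau>_def using n(1)
        by (auto simp: set_conv_nth image_iff split: if_splits)
    qed
    ultimately show "F \<in> (\<lambda>\<sigma>. g ` \<sigma>) ` bipyramid_boundary n" by blast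
  next
    fix F assume "F \<in> (\<lambda>\<sigma>. g ` \<sigma>) ` bipyramid_boundary n"
    then obtain \<sigma> \<tau> where F: "F = g ` (\<sigma> <+> \<tau>)" "\<sigma> \<in> graph_complex (cycle_graph n)" "\<tau> \<in> two_points"
      unfolding B by blast
    note s = cyc_face[OF F(2)]
    have mem: "cs ! i \<in> set cs" if "i \<in> \<sigma>" for i using s that n(1) by (auto intro!: nth_mem)
    have 1: "cs ! i \<inter> cs ! j = {}" if "i \<in> \<sigma>" "j \<in> \<sigma>" "cs ! i \<noteq> cs ! j" for i j
      using cyc[of i j] s that by (metis lessThan_iff subsetD)
    define C where "C = (!) cs ` \<sigma>"
    define T where "T = (\<lambda>b. if b then q else p) ` \<tau>"
    have "\<tau> = {} \<or> \<tau> = {False} \<or> \<tau> = {True}" using F(3) by (auto simp: two_points_def)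
    then have T: "T = {} \<or> T = {p} \<or> T = {q}" unfolding T_def by (elim disjE) simp_all
    have CC: "e \<inter> f = {}" if "e \<in> C" "f \<in> C" "e \<noteq> f" for e f using 1 that unfolding C_def by blast
    have "C \<subseteq> set cs" using mem by (auto simp: C_def)
    then have CT: "e \<inter> f = {}" "f \<inter> e = {}" if "e \<in> C" "f \<in> T" for e f
      using off[of e] T that by (auto simp: Int_commute)
    have "C \<union> T \<subseteq> edges G" unfolding E using \<open>C \<subseteq> set cs\<close> T by blast
    moreover have "e \<inter> f = {}" if ef: "e \<in> C \<union> T" "f \<in> C \<union> T" "e \<noteq> f" for e f
    proof -
      have "\<not> (e \<in> T \<and> f \<in> T)" using T ef(3) by blast
      then consider "e \<in> C" "f \<in> C" | "e \<in> C" "f \<in> T" | "e \<in> T" "f \<in> C" using ef(1,2) by blast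
      then show ?thesis by cases (use CC CT ef(3) in metis)+
    qed
    ultimately show "F \<in> matching_complex G"
      unfolding F(1) img in_matching_complex C_def[symmetric] T_def[symmetric] by blast
  qed
  ultimately show "complex_iso (bipyramid_boundary n) (matching_complex G)"
    unfolding complex_iso_def UB by auto
qed

lemma not_connected_if_component:
  assumes "C \<subseteq> verts G" "C \<noteq> {}" "w \<in> verts G" "w \<notin> C"
    and closed: "\<And>x y. x \<in> C \<Longrightarrow> {x, y} \<in> edges G \<Longrightarrow> y \<in> C"
  shows "\<not> connected_graph G"
proof
  assume conn: "connected_graph G"
  obtain u where u: "u \<in> C" using assms(2) by blast
  then have "(u, w) \<in> {(x, y). {x, y} \<in> edges G}\<^sup>*"
    using conn assms(1,3) by (auto simp: connected_graph_def)
  then have "w \<in> C" using u by (induction rule: rtrancl_induct) (use closed in auto)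
  then show False using assms(4) by simp
qed

lemma verts_eq_Union_edges:
  assumes "finite_simple_graph G" "no_isolated_vertices G"
  shows "verts G = \<Union>(edges G)"
  using assms by (auto simp: finite_simple_graph_def no_isolated_vertices_def)

lemma edges_path_graph_3: "edges (path_graph 3) = {{0, 1}, {1, 2}}"
proof -
  have "{{i, i + 1} | i :: nat. i + 1 < 3} = (\<lambda>i. {i, i + 1}) ` {0, 1}" by auto
  then show ?thesis by (simp add: path_graph_def numeral_2_eq_2)
qed

lemma edges_cycle_graph_5: "edges (cycle_graph 5) = {{0, 1}, {1, 2}, {2, 3}, {3, 4}, {4, 0}}"
proof -
  have "{..<5} = {0, 1, 2, 3, 4 :: nat}" by auto
  moreover have "{{i, (i + 1) mod 5} | i :: nat. i < 5} = (\<lambda>i. {i, (i + 1) mod 5}) ` {..<5}" by auto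
  ultimately show ?thesis by (simp add: cycle_graph_def numeral_2_eq_2)
qed

lemma edges_complete_bipartite_3_2: "edges (complete_bipartite_graph 3 2) =
   {{Inl 0, Inr 0}, {Inl 1, Inr 0}, {Inl 2, Inr 0}, {Inl 0, Inr 1}, {Inl 1, Inr 1}, {Inl 2, Inr 1}}"
proof -
  have "{..<3} = {0, 1, 2 :: nat}" "{..<2} = {0, 1 :: nat}" by auto
  moreover have "{{Inl i, Inr j} | i j. i < 3 \<and> j < 2} =
     (\<lambda>(i, j). {Inl i, Inr j}) ` ({..<3 :: nat} \<times> {..<2 :: nat})" by auto
  ultimately show ?thesis by (auto simp: complete_bipartite_graph_def)
qed

lemma lessThan_explicit:
  "{..<3} = {0, 1, 2 :: nat}" "{..<5} = {0, 1, 2, 3, 4 :: nat}" "{..<2} = {0, 1 :: nat}"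
  by auto

lemma less_cases:
  "i < 4 \<Longrightarrow> i = 0 \<or> i = 1 \<or> i = 2 \<or> i = (3::nat)"
  "i < 5 \<Longrightarrow> i = 0 \<or> i = 1 \<or> i = 2 \<or> i = 3 \<or> i = (4::nat)"
  "i < 6 \<Longrightarrow> i = 0 \<or> i = 1 \<or> i = 2 \<or> i = 3 \<or> i = 4 \<or> i = (5::nat)"
  by auto

lemma edges_3P3: "edges (copies_graph 3 (path_graph 3)) =
  {{(0, 0), (0, 1)}, {(0, 1), (0, 2)}, {(1, 0), (1, 1)}, {(1, 1), (1, 2)}, {(2, 0), (2, 1)}, {(2, 1), (2, 2)}}"
proof -
  have "{Pair i ` e | i e. i < 3 \<and> e \<in> edges (path_graph 3)}
      = (\<lambda>(i, e). Pair i ` e) ` ({..<3 :: nat} \<times> edges (path_graph 3))" by auto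
  then show ?thesis by (simp add: copies_graph_def edges_path_graph_3 lessThan_explicit insert_Times_insert)
qed

lemma edges_P3_C5: "edges (disjoint_union_graph (path_graph 3) (cycle_graph 5)) =
  {{Inl 0, Inl 1}, {Inl 1, Inl 2}, {Inr 0, Inr 1}, {Inr 1, Inr 2}, {Inr 2, Inr 3}, {Inr 3, Inr 4}, {Inr 4, Inr 0}}"
  unfolding disjoint_union_graph_def graph.simps edges_path_graph_3 edges_cycle_graph_5
    image_insert image_empty Un_insert_left Un_empty_left ..

lemma edges_P3_K32: "edges (disjoint_union_graph (path_graph 3) (complete_bipartite_graph 3 2)) =
  {{Inl 0, Inl 1}, {Inl 1, Inl 2},
   {Inr (Inl 0), Inr (Inr 0)}, {Inr (Inl 1), Inr (Inr 0)}, {Inr (Inl 2), Inr (Inr 0)},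
   {Inr (Inl 0), Inr (Inr 1)}, {Inr (Inl 1), Inr (Inr 1)}, {Inr (Inl 2), Inr (Inr 1)}}"
  unfolding disjoint_union_graph_def graph.simps edges_path_graph_3 edges_complete_bipartite_3_2
    image_insert image_empty Un_insert_left Un_empty_left ..

text \<open>
  The edges of the part that is not the path \<open>x - y - z\<close> are listed in the order in which consecutive
  ones are disjoint; this exhibits the circle in the matching complex.
\<close>

lemma P3_plus_circle_conclusion:
  assumes G: "finite_simple_graph G" "no_isolated_vertices G" and P: "is_P3_plus_circle (edges G)"
  shows "(graph_iso G (copies_graph 3 (path_graph 3)) \<or>
          graph_iso G (disjoint_union_graph (path_graph 3) (cycle_graph 5)) \<or>
          graph_iso G (disjoint_union_graph (path_graph 3) (complete_bipartite_graph 3 2))) \<and>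
         (\<exists>n \<in> {4, 5, 6}. complex_iso (matching_complex G) (bipyramid_boundary n)) \<and>
         \<not> connected_graph G"
proof -
  obtain x y z R where xyz: "distinct [x, y, z]" "{x, y, z} \<inter> \<Union>R = {}"
    and E: "edges G = {{x, y}, {y, z}} \<union> R" and R: "is_2P3 R \<or> is_C5 R \<or> is_K32 R"
    using P unfolding is_P3_plus_circle_def by (elim exE conjE) (rule that)
  have V: "verts G = \<Union>(edges G)" by (rule verts_eq_Union_edges[OF G])
  have off: "{x, y} \<inter> c = {} \<and> {y, z} \<inter> c = {}" if "c \<in> R" for c using xyz(2) that by blast
  have xz: "{x, y} \<noteq> {y, z}" using xyz(1) by (auto simp: doubleton_eq_iff)
  have notR: "{x, y} \<notin> R" "{y, z} \<notin> R" using off by auto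
  have bip: "complex_iso (matching_complex G) (bipyramid_boundary n)"
    if "length cs = n" "n \<ge> 4" "distinct cs" "R = set cs"
      "\<And>i j. i < n \<Longrightarrow> j < n \<Longrightarrow> i \<noteq> j \<Longrightarrow> cs ! i \<inter> cs ! j = {} \<longleftrightarrow> cyclically_adjacent n i j" for n cs
    by (rule matching_complex_bipyramid[of cs n "{x, y}" "{y, z}"]) (use that notR xz off E in auto)
  have conn: "\<not> connected_graph G"
  proof -
    have "\<exists>a b S. R = insert {a, b} S"
      using R
    proof (elim disjE)
      assume "is_2P3 R" then show ?thesis unfolding is_2P3_def by metis
    next
      assume "is_C5 R" then show ?thesis unfolding is_C5_def by metis
    next
      assume "is_K32 R" then show ?thesis unfolding is_K32_def by metis
    qed
    then obtain c w where cw: "c \<in> R" "w \<in> c" by blast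
    show ?thesis
    proof (rule not_connected_if_component[of "{x, y, z}" G w])
      show "w \<in> verts G" unfolding V E using cw by blast
      show "{x, y, z} \<subseteq> verts G" unfolding V E by blast
      show "w \<notin> {x, y, z}" using cw xyz(2) by blast
      show "t \<in> {x, y, z}" if "s \<in> {x, y, z}" "{s, t} \<in> edges G" for s t
      proof -
        have "{s, t} \<notin> R" using xyz(2) that(1) by blast
        then have "{s, t} = {x, y} \<or> {s, t} = {y, z}" using that(2) unfolding E by simp
        then have "t \<in> {x, y} \<or> t \<in> {y, z}" by (metis insertI1 insert_commute)
        then show ?thesis by blast
      qed
    qed simp
  qed
  from R show ?thesis
  proof (elim disjE)
    assume "is_2P3 R"
    then obtain x1 w x2 y1 v y2 where d: "distinct [x1, w, x2, y1, v, y2]"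
      and Req: "R = {{x1, w}, {w, x2}, {y1, v}, {v, y2}}"
      unfolding is_2P3_def by (elim exE conjE) (rule that)
    have "graph_iso G (copies_graph 3 (path_graph 3))"
    proof (rule graph_iso_lists[of "[x, y, z, x1, w, x2, y1, v, y2]"
          "[(0, 0), (0, 1), (0, 2), (1, 0), (1, 1), (1, 2), (2, 0), (2, 1), (2, 2)]" _ _
          "[(0, 1), (1, 2), (3, 4), (4, 5), (6, 7), (7, 8)]"])
      show "distinct [x, y, z, x1, w, x2, y1, v, y2]" using xyz d unfolding Req by auto
      show "verts G = set [x, y, z, x1, w, x2, y1, v, y2]" unfolding V E Req by auto
      show "verts (copies_graph 3 (path_graph 3)) = set [(0, 0), (0, 1), (0, 2), (1, 0), (1, 1), (1, 2), (2, 0), (2, 1), (2, 2)]"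
        by (auto simp: copies_graph_def path_graph_def lessThan_explicit)
      show "edges G = (\<lambda>(i, j). {[x, y, z, x1, w, x2, y1, v, y2] ! i, [x, y, z, x1, w, x2, y1, v, y2] ! j}) ` set [(0, 1), (1, 2), (3, 4), (4, 5), (6, 7), (7, 8)]"
        unfolding E Req Un_insert_left Un_empty_left by simp
    qed (simp_all add: edges_3P3)
    moreover have "complex_iso (matching_complex G) (bipyramid_boundary 4)"
    proof (rule bip[of "[{x1, w}, {y1, v}, {w, x2}, {v, y2}]"])
      show "distinct [{x1, w}, {y1, v}, {w, x2}, {v, y2}]" using d by (auto simp: doubleton_eq_iff)
      fix i j :: nat assume ij: "i < 4" "j < 4" "i \<noteq> j"
      from less_cases(1)[OF ij(1)] less_cases(1)[OF ij(2)]
      show "[{x1, w}, {y1, v}, {w, x2}, {v, y2}] ! i \<inter> [{x1, w}, {y1, v}, {w, x2}, {v, y2}] ! j = {} \<longleftrightarrow>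
          cyclically_adjacent 4 i j"
        using ij(3) d[simplified] d[THEN distinct_rev[THEN iffD2], simplified] unfolding cyclically_adjacent_def
        by (elim disjE; hypsubst) (simp_all (no_asm_simp))
    qed (auto simp: Req)
    ultimately show ?thesis using conn by blast
  next
    assume "is_C5 R"
    then obtain a b c e f where d: "distinct [a, b, c, e, f]"
      and Req: "R = {{a, b}, {b, c}, {c, e}, {e, f}, {f, a}}"
      unfolding is_C5_def by (elim exE conjE) (rule that)
    have "graph_iso G (disjoint_union_graph (path_graph 3) (cycle_graph 5))"
    proof (rule graph_iso_lists[of "[x, y, z, a, b, c, e, f]"
          "[Inl 0, Inl 1, Inl 2, Inr 0, Inr 1, Inr 2, Inr 3, Inr 4]" _ _
          "[(0, 1), (1, 2), (3, 4), (4, 5), (5, 6), (6, 7), (7, 3)]"])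
      show "distinct [x, y, z, a, b, c, e, f]" using xyz d unfolding Req by auto
      show "verts G = set [x, y, z, a, b, c, e, f]" unfolding V E Req by auto
      show "verts (disjoint_union_graph (path_graph 3) (cycle_graph 5)) =
          set [Inl 0, Inl 1, Inl 2, Inr 0, Inr 1, Inr 2, Inr 3, Inr 4]"
        by (auto simp: disjoint_union_graph_def path_graph_def cycle_graph_def lessThan_explicit)
      show "edges G = (\<lambda>(i, j). {[x, y, z, a, b, c, e, f] ! i, [x, y, z, a, b, c, e, f] ! j}) ` set [(0, 1), (1, 2), (3, 4), (4, 5), (5, 6), (6, 7), (7, 3)]"
        unfolding E Req Un_insert_left Un_empty_left by simp
    qed (simp_all add: edges_P3_C5)
    moreover have "complex_iso (matching_complex G) (bipyramid_boundary 5)"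
    proof (rule bip[of "[{a, b}, {c, e}, {f, a}, {b, c}, {e, f}]"])
      show "distinct [{a, b}, {c, e}, {f, a}, {b, c}, {e, f}]" using d by (auto simp: doubleton_eq_iff)
      fix i j :: nat assume ij: "i < 5" "j < 5" "i \<noteq> j"
      from less_cases(2)[OF ij(1)] less_cases(2)[OF ij(2)]
      show "[{a, b}, {c, e}, {f, a}, {b, c}, {e, f}] ! i \<inter> [{a, b}, {c, e}, {f, a}, {b, c}, {e, f}] ! j = {} \<longleftrightarrow>
          cyclically_adjacent 5 i j"
        using ij(3) d[simplified] d[THEN distinct_rev[THEN iffD2], simplified] unfolding cyclically_adjacent_def
        by (elim disjE; hypsubst) (simp_all (no_asm_simp))
    qed (auto simp: Req)
    ultimately show ?thesis using conn by blast
  next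
    assume "is_K32 R"
    then obtain s t u a b where d: "distinct [s, t, u, a, b]"
      and Req: "R = {{s, a}, {t, a}, {u, a}, {s, b}, {t, b}, {u, b}}"
      unfolding is_K32_def by (elim exE conjE) (rule that)
    have "graph_iso G (disjoint_union_graph (path_graph 3) (complete_bipartite_graph 3 2))"
    proof (rule graph_iso_lists[of "[x, y, z, s, t, u, a, b]"
          "[Inl 0, Inl 1, Inl 2, Inr (Inl 0), Inr (Inl 1), Inr (Inl 2), Inr (Inr 0), Inr (Inr 1)]" _ _
          "[(0, 1), (1, 2), (3, 6), (4, 6), (5, 6), (3, 7), (4, 7), (5, 7)]"])
      show "distinct [x, y, z, s, t, u, a, b]" using xyz d unfolding Req by auto
      show "verts G = set [x, y, z, s, t, u, a, b]" unfolding V E Req by auto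
      show "verts (disjoint_union_graph (path_graph 3) (complete_bipartite_graph 3 2)) =
          set [Inl 0, Inl 1, Inl 2, Inr (Inl 0), Inr (Inl 1), Inr (Inl 2), Inr (Inr 0), Inr (Inr 1)]"
        by (auto simp: disjoint_union_graph_def path_graph_def complete_bipartite_graph_def lessThan_explicit)
      show "edges G = (\<lambda>(i, j). {[x, y, z, s, t, u, a, b] ! i, [x, y, z, s, t, u, a, b] ! j}) ` set [(0, 1), (1, 2), (3, 6), (4, 6), (5, 6), (3, 7), (4, 7), (5, 7)]"
        unfolding E Req Un_insert_left Un_empty_left by simp
    qed (simp_all add: edges_P3_K32)
    moreover have "complex_iso (matching_complex G) (bipyramid_boundary 6)"
    proof (rule bip[of "[{s, a}, {t, b}, {u, a}, {s, b}, {t, a}, {u, b}]"])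
      show "distinct [{s, a}, {t, b}, {u, a}, {s, b}, {t, a}, {u, b}]" using d by (auto simp: doubleton_eq_iff)
      fix i j :: nat assume ij: "i < 6" "j < 6" "i \<noteq> j"
      from less_cases(3)[OF ij(1)] less_cases(3)[OF ij(2)]
      show "[{s, a}, {t, b}, {u, a}, {s, b}, {t, a}, {u, b}] ! i \<inter>
            [{s, a}, {t, b}, {u, a}, {s, b}, {t, a}, {u, b}] ! j = {} \<longleftrightarrow> cyclically_adjacent 6 i j"
        using ij(3) d[simplified] d[THEN distinct_rev[THEN iffD2], simplified] unfolding cyclically_adjacent_def
        by (elim disjE; hypsubst) (simp_all (no_asm_simp))
    qed (auto simp: Req)
    ultimately show ?thesis using conn by blast
  qed
qed

section \<open>Graphs whose matching complex is a two-dimensional sphere\<close>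

theorem theorem3p2:
  fixes G :: "'a graph"
  assumes "finite_simple_graph G"
    and "no_isolated_vertices G"
    and "homology_sphere TYPE('k::field) 2 (matching_complex G)"
  shows "(graph_iso G (copies_graph 3 (path_graph 3)) \<or>
          graph_iso G (disjoint_union_graph (path_graph 3) (cycle_graph 5)) \<or>
          graph_iso G (disjoint_union_graph (path_graph 3) (complete_bipartite_graph 3 2))) \<and>
         (\<exists>n \<in> {4, 5, 6}. complex_iso (matching_complex G) (bipyramid_boundary n)) \<and>
         \<not> connected_graph G"
proof (cases rule: locally_circle_cases[OF locally_circle_if_homology_sphere[OF assms(1,3)]])
  case 1
  then show ?thesis by (rule P3_plus_circle_conclusion[OF assms(1,2)])
next
  case (2 X A)
  \<comment> \<open>The homology of the whole complex is that of the link of the empty face.\<close>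
  have "link (matching_complex G) {} = matching_complex G" by (auto simp: link_def)
  moreover have "{} \<in> matching_complex G" by (simp add: in_matching_complex)
  ultimately have "homology_trivial TYPE('k) (matching_complex G) 1"
    using assms(3) unfolding homology_sphere_def has_homology_of_sphere_def
    by (metis card.empty diff_zero numeral_One of_nat_0 one_neq_zero numeral_eq_iff semiring_norm(85))
  with 2 show ?thesis using homology_nontrivial_matching_complex_K43 by blast
qed

end
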